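(* Let $n\ge1$ and let $Z\in2^\omega$ be density random relative to $\emptyset^{(n-1)}$. Let $P$ be a $\Pi^0_n$ class with $Z\in P$. Then $\underline\varrho_2(P\mid Z)=1$.
   Context: $\lambda$ is the uniform measure on $2^\omega$; $\lambda_\sigma(\mathcal C)=2^{|\sigma|}\lambda(\mathcal C\cap[\sigma])$; $\underline\varrho_2(\mathcal C\mid Z)=\liminf_n\lambda_{Z\upharpoonright n}(\mathcal C)$. $Z$ is density random relative to an oracle $X$ if $Z$ is Martin-Löf random relative to $X$ and $\underline\varrho_2(\mathcal C\mid Z)=1$ for every $\Pi^{0,X}_1$ class (effectively closed relative to $X$) $\mathcal C$ containing $Z$. *)

theory Defs
  imports "HOL-Probability.Probability" "HOL-Library.Nat_Bijection"
begin

section \<open>Computability relative to an oracle\<close>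

text \<open>
  Programs for the unary functions that are partial recursive in an oracle set. Tuples are coded
  with the Cantor pairing \<^const>\<open>prod_encode\<close>, which makes unary functions suffice.
\<close>

datatype prog =
    PZero | PSucc | PFst | PSnd | POracle
  | PPair prog prog | PComp prog prog | PRec prog prog | PMin prog

text \<open>\<open>runs A p x y\<close>: program \<open>p\<close> with oracle \<open>A\<close> halts on input \<open>x\<close> with output \<open>y\<close>.\<close>

inductive runs :: "nat set \<Rightarrow> prog \<Rightarrow> nat \<Rightarrow> nat \<Rightarrow> bool" for A where
  zero: "runs A PZero x 0"
| succ: "runs A PSucc x (Suc x)"
| fst: "runs A PFst x (fst (prod_decode x))"
| snd: "runs A PSnd x (snd (prod_decode x))"
| query: "runs A POracle x (of_bool (x \<in> A))"
| pair: "runs A p x y \<Longrightarrow> runs A q x z \<Longrightarrow> runs A (PPair p q) x (prod_encode (y, z))"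
| comp: "runs A q x y \<Longrightarrow> runs A p y z \<Longrightarrow> runs A (PComp p q) x z"
| rec_0: "runs A p a y \<Longrightarrow> runs A (PRec p q) (prod_encode (a, 0)) y"
| rec_Suc: "runs A (PRec p q) (prod_encode (a, n)) y \<Longrightarrow>
    runs A q (prod_encode (a, prod_encode (n, y))) z \<Longrightarrow>
    runs A (PRec p q) (prod_encode (a, Suc n)) z"
| min: "runs A p (prod_encode (a, n)) 0 \<Longrightarrow>
    (\<forall>i<n. \<exists>y. runs A p (prod_encode (a, i)) (Suc y)) \<Longrightarrow>
    runs A (PMin p) a n"

primrec goedel :: "prog \<Rightarrow> nat" where
  "goedel PZero = prod_encode (0, 0)"
| "goedel PSucc = prod_encode (1, 0)"
| "goedel PFst = prod_encode (2, 0)"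
| "goedel PSnd = prod_encode (3, 0)"
| "goedel POracle = prod_encode (4, 0)"
| "goedel (PPair p q) = prod_encode (5, prod_encode (goedel p, goedel q))"
| "goedel (PComp p q) = prod_encode (6, prod_encode (goedel p, goedel q))"
| "goedel (PRec p q) = prod_encode (7, prod_encode (goedel p, goedel q))"
| "goedel (PMin p) = prod_encode (8, goedel p)"

text \<open>
  The Turing jump. Numbers that code no program count as indices of the nowhere defined function.
\<close>

definition jump :: "nat set \<Rightarrow> nat set" where
  "jump A = {goedel p | p. \<exists>y. runs A p (goedel p) y}"

definition iter_jump :: "nat \<Rightarrow> nat set" where
  "iter_jump k = (jump ^^ k) {}"

definition ce_in :: "nat set \<Rightarrow> nat set \<Rightarrow> bool" where
  "ce_in A S \<longleftrightarrow> (\<exists>p. S = {x. \<exists>y. runs A p x y})"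


section \<open>Cantor space\<close>

type_synonym cantor = "nat \<Rightarrow> bool"

definition init_seg :: "cantor \<Rightarrow> nat \<Rightarrow> bool list" where
  "init_seg Z n = map Z [0..<n]"

definition cylinder :: "bool list \<Rightarrow> cantor set" where
  "cylinder \<sigma> = {Z. init_seg Z (length \<sigma>) = \<sigma>}"

definition string_code :: "bool list \<Rightarrow> nat" where
  "string_code \<sigma> = list_encode (map of_bool \<sigma>)"

definition uniform_measure_cantor :: "cantor measure" where
  "uniform_measure_cantor = (\<Pi>\<^sub>M i\<in>UNIV. measure_pmf (bernoulli_pmf (1/2)))"

definition local_measure :: "bool list \<Rightarrow> cantor set \<Rightarrow> real" where
  "local_measure \<sigma> C = 2 ^ length \<sigma> * measure uniform_measure_cantor (C \<inter> cylinder \<sigma>)"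

definition lower_density :: "cantor set \<Rightarrow> cantor \<Rightarrow> ereal" where
  "lower_density C Z = liminf (\<lambda>n. ereal (local_measure (init_seg Z n) C))"


section \<open>Arithmetical classes\<close>

text \<open>
  \<open>sigma_form k R Z\<close> is the statement
  \<open>\<exists>y\<^sub>1 \<forall>y\<^sub>2 \<dots> Q y\<^sub>k Q' y. R [y\<^sub>1, \<dots>, y\<^sub>k] (Z restricted to y)\<close> with \<open>k + 1\<close> alternating
  quantifiers; \<open>pi_form k R Z\<close> is the same with the quantifier block starting with \<open>\<forall>\<close>.
\<close>

fun sigma_form pi_form :: "nat \<Rightarrow> (nat list \<Rightarrow> bool list \<Rightarrow> bool) \<Rightarrow> cantor \<Rightarrow> bool" where
  "sigma_form 0 R Z \<longleftrightarrow> (\<exists>y. R [] (init_seg Z y))"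
| "sigma_form (Suc k) R Z \<longleftrightarrow> (\<exists>y. pi_form k (\<lambda>ys. R (y # ys)) Z)"
| "pi_form 0 R Z \<longleftrightarrow> (\<forall>y. R [] (init_seg Z y))"
| "pi_form (Suc k) R Z \<longleftrightarrow> (\<forall>y. sigma_form k (\<lambda>ys. R (y # ys)) Z)"

definition computable_rel_in :: "nat set \<Rightarrow> (nat list \<Rightarrow> bool list \<Rightarrow> bool) \<Rightarrow> bool" where
  "computable_rel_in A R \<longleftrightarrow>
    (\<exists>p. \<forall>ys \<sigma>. runs A p (prod_encode (list_encode ys, string_code \<sigma>)) (of_bool (R ys \<sigma>)))"

text \<open>\<open>pi_class A n C\<close>: \<open>C\<close> is a (lightface) \<open>\<Pi>\<^sup>0\<^sub>n\<close> class relative to \<open>A\<close>, for \<open>n \<ge> 1\<close>.\<close>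

definition pi_class :: "nat set \<Rightarrow> nat \<Rightarrow> cantor set \<Rightarrow> bool" where
  "pi_class A n C \<longleftrightarrow>
    n \<ge> 1 \<and> (\<exists>R. computable_rel_in A R \<and> C = {Z. pi_form (n - 1) R Z})"


section \<open>Randomness\<close>

text \<open>
  A Martin-Loef test is given by a set \<open>W\<close> of codes of pairs \<open>(m, \<sigma>)\<close>, c.e. in the oracle; its
  \<open>m\<close>-th component is the open class generated by the strings \<open>\<sigma>\<close> with \<open>(m, \<sigma>)\<close> in \<open>W\<close>.
\<close>

definition test_component :: "nat set \<Rightarrow> nat \<Rightarrow> cantor set" where
  "test_component W m = (\<Union>\<sigma>\<in>{\<sigma>. prod_encode (m, string_code \<sigma>) \<in> W}. cylinder \<sigma>)"

definition ml_test_in :: "nat set \<Rightarrow> nat set \<Rightarrow> bool" where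
  "ml_test_in A W \<longleftrightarrow> ce_in A W \<and>
    (\<forall>m. measure uniform_measure_cantor (test_component W m) \<le> (1/2) ^ m)"

definition ml_random_in :: "nat set \<Rightarrow> cantor \<Rightarrow> bool" where
  "ml_random_in A Z \<longleftrightarrow> (\<forall>W. ml_test_in A W \<longrightarrow> Z \<notin> (\<Inter>m. test_component W m))"

definition density_random_in :: "nat set \<Rightarrow> cantor \<Rightarrow> bool" where
  "density_random_in A Z \<longleftrightarrow> ml_random_in A Z \<and>
    (\<forall>C. pi_class A 1 C \<and> Z \<in> C \<longrightarrow> lower_density C Z = 1)"

end

theory Submission
  imports Defs
begin

text \<open>
  Write \<open>P\<close> as \<open>\<Inter>\<^sub>y S\<^sub>y\<close> with \<open>S\<^sub>y\<close> uniformly \<open>\<Sigma>\<^sup>0\<close> of level \<open>n - 1\<close>. By recursion on the level, the jump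
  \<open>A = iter_jump (n - 1)\<close> computes clopen sets \<open>D y i\<close> that converge to \<open>S\<^sub>y\<close> in measure so fast that the differences of
  consecutive approximations form a Martin-Loef test. On a point \<open>Z\<close> passing that test the truth
  values of \<open>Z \<in> D y i\<close> are constant for \<open>i \<ge> m\<close>, with the same \<open>m\<close> for all \<open>y\<close>, and the limit is
  the truth value of \<open>Z \<in> S\<^sub>y\<close>. So \<open>Z\<close> lies in \<open>Q = \<Inter>{D y i | y i. i \<ge> m}\<close>, which is \<open>\<Pi>\<^sup>0\<^sub>1\<close>
  relative to \<open>A\<close> and, as almost every point passes the test, contained in \<open>P\<close> up to a null set. Density
  randomness gives \<open>Q\<close> lower density 1 at \<open>Z\<close>, hence also \<open>P\<close>.
\<close>

section \<open>Computable functions\<close>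

abbreviation pfst :: "nat \<Rightarrow> nat" where "pfst x \<equiv> fst (prod_decode x)"
abbreviation psnd :: "nat \<Rightarrow> nat" where "psnd x \<equiv> snd (prod_decode x)"

definition computable :: "nat set \<Rightarrow> (nat \<Rightarrow> nat) \<Rightarrow> bool" where
  "computable A f \<longleftrightarrow> (\<exists>p. \<forall>x. runs A p x (f x))"

text \<open>Predicates are 0/1-valued functions, so that \<open>computable_intros\<close> can
  decompose functions and predicates alike.\<close>

abbreviation decidable :: "nat set \<Rightarrow> (nat \<Rightarrow> bool) \<Rightarrow> bool" where
  "decidable A P \<equiv> computable A (\<lambda>x. of_bool (P x))"

abbreviation computable2 :: "nat set \<Rightarrow> (nat \<Rightarrow> nat \<Rightarrow> nat) \<Rightarrow> bool" where
  "computable2 A f \<equiv> computable A (\<lambda>x. f (pfst x) (psnd x))"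

named_theorems computable_intros

lemma computableI: "(\<And>x. runs A p x (f x)) \<Longrightarrow> computable A f"
  unfolding computable_def by blast

lemma computable_comp:
  assumes "computable A f" "computable A g"
  shows "computable A (\<lambda>x. f (g x))"
  using assms unfolding computable_def by (meson runs.comp)

lemma computable_id [computable_intros]: "computable A (\<lambda>x. x)"
proof -
  \<comment> \<open>There is no identity program; pairing the two projections reproduces the input
    because Cantor pairing is surjective.\<close>
  have "runs A (PPair PFst PSnd) x x" for x
    using runs.pair[OF runs.fst[of A x] runs.snd] by simp
  then show ?thesis
    by (rule computableI)
qed

lemma computable_Suc [computable_intros]:
  "computable A f \<Longrightarrow> computable A (\<lambda>x. Suc (f x))"
  by (rule computable_comp[of A Suc]) (rule computableI[OF runs.succ])

lemma computable_const [computable_intros]: "computable A (\<lambda>x. c)"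
proof (induction c)
  case 0
  show ?case by (rule computableI[OF runs.zero])
qed (rule computable_Suc)

lemma computable_pfst [computable_intros]:
  "computable A f \<Longrightarrow> computable A (\<lambda>x. pfst (f x))"
  by (rule computable_comp[of A "\<lambda>x. pfst x"]) (rule computableI[OF runs.fst])

lemma computable_psnd [computable_intros]:
  "computable A f \<Longrightarrow> computable A (\<lambda>x. psnd (f x))"
  by (rule computable_comp[of A "\<lambda>x. psnd x"]) (rule computableI[OF runs.snd])

lemma computable_prod_encode [computable_intros]:
  "computable A f \<Longrightarrow> computable A g \<Longrightarrow> computable A (\<lambda>x. prod_encode (f x, g x))"
  unfolding computable_def by (meson runs.pair)

lemma decidable_oracle [computable_intros]:
  "computable A f \<Longrightarrow> decidable A (\<lambda>x. f x \<in> A)"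
  by (rule computable_comp[of A "\<lambda>x. of_bool (x \<in> A)"]) (rule computableI[OF runs.query])

lemma computable2_comp:
  assumes "computable2 A f" "computable A g" "computable A h"
  shows "computable A (\<lambda>x. f (g x) (h x))"
  using computable_comp[OF assms(1) computable_prod_encode[OF assms(2,3)]] by simp

text \<open>\<open>PRec\<close> carries the parameter \<open>x\<close> in the first component and
  counts in the second, so the step may depend on \<open>x\<close>; the bound \<open>n x\<close> is
  then substituted for the counter. Addition, multiplication, powers and subtraction are
  instances.\<close>

lemma computable_rec_nat [computable_intros]:
  assumes "computable A g"
    and "computable A (\<lambda>z. h (pfst z) (pfst (psnd z)) (psnd (psnd z)))"
    and "computable A n"
  shows "computable A (\<lambda>x. rec_nat (g x) (h x) (n x))"
proof (rule computable2_comp[OF _ computable_id assms(3)])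
  from assms(1,2) obtain p q where p: "\<And>x. runs A p x (g x)"
    and q: "\<And>z. runs A q z (h (pfst z) (pfst (psnd z)) (psnd (psnd z)))"
    unfolding computable_def by blast
  have "runs A (PRec p q) (prod_encode (a, n)) (rec_nat (g a) (h a) n)" for a n
  proof (induction n)
    case 0
    show ?case using runs.rec_0[OF p] by simp
  next
    case (Suc n)
    have "runs A q (prod_encode (a, prod_encode (n, r))) (h a n r)" for r
      using q[of "prod_encode (a, prod_encode (n, r))"] by simp
    from runs.rec_Suc[OF Suc this] show ?case by simp
  qed
  from this[of "pfst x" "psnd x" for x] show "computable2 A (\<lambda>x n. rec_nat (g x) (h x) n)"
    unfolding computable_def by (metis prod.collapse prod_decode_inverse)
qed

section \<open>Arithmetic operations\<close>

lemma computable_add [computable_intros]: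
  assumes [computable_intros]: "computable A f" "computable A g"
  shows "computable A (\<lambda>x. f x + g x)"
proof -
  have "computable A (\<lambda>x. rec_nat (f x) (\<lambda>_ r. Suc r) (g x))"
    by (intro computable_intros)
  moreover have "rec_nat a (\<lambda>_ r. Suc r) b = a + b" for a b :: nat
    by (induction b) auto
  ultimately show ?thesis by simp
qed

lemma computable_mult [computable_intros]:
  assumes [computable_intros]: "computable A f" "computable A g"
  shows "computable A (\<lambda>x. f x * g x)"
proof -
  have "computable A (\<lambda>x. rec_nat 0 (\<lambda>_ r. r + f x) (g x))"
    by (intro computable_intros computable_comp[OF assms(1)])
  moreover have "rec_nat 0 (\<lambda>_ r. r + a) b = a * b" for a b :: nat
    by (induction b) auto
  ultimately show ?thesis by simp
qed

lemma computable_power [computable_intros]: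
  assumes [computable_intros]: "computable A f" "computable A g"
  shows "computable A (\<lambda>x. f x ^ g x)"
proof -
  have "computable A (\<lambda>x. rec_nat 1 (\<lambda>_ r. r * f x) (g x))"
    by (intro computable_intros computable_comp[OF assms(1)])
  moreover have "rec_nat 1 (\<lambda>_ r. r * a) b = a ^ b" for a b :: nat
    by (induction b) auto
  ultimately show ?thesis by simp
qed

lemma computable_diff [computable_intros]:
  assumes [computable_intros]: "computable A f" "computable A g"
  shows "computable A (\<lambda>x. f x - g x)"
proof -
  \<comment> \<open>Recursion that returns its counter is the predecessor; iterating it gives
    truncated subtraction.\<close>
  have "computable A (\<lambda>x. rec_nat 0 (\<lambda>k _. k) x)"
    by (intro computable_intros)
  moreover have "rec_nat 0 (\<lambda>k _. k) b = b - 1" for b :: nat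
    by (cases b) auto
  ultimately have pred: "computable A (\<lambda>x. x - 1)" by simp
  have "computable A (\<lambda>x. rec_nat (f x) (\<lambda>_ r. r - 1) (g x))"
    by (intro computable_intros computable_comp[OF pred])
  moreover have "rec_nat a (\<lambda>_ r. r - 1) b = a - b" for a b :: nat
    by (induction b) auto
  ultimately show ?thesis by simp
qed

section \<open>Boolean connectives and comparisons\<close>

lemma decidable_not [computable_intros]:
  assumes [computable_intros]: "decidable A P"
  shows "decidable A (\<lambda>x. \<not> P x)"
proof -
  have "computable A (\<lambda>x. 1 - of_bool (P x))" by (intro computable_intros)
  moreover have "1 - of_bool (P x) = (of_bool (\<not> P x) :: nat)" for x
    by (cases "P x") auto
  ultimately show ?thesis by simp
qed

lemma decidable_conj [computable_intros]:
  assumes [computable_intros]: "decidable A P" "decidable A Q"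
  shows "decidable A (\<lambda>x. P x \<and> Q x)"
proof -
  have "computable A (\<lambda>x. of_bool (P x) * of_bool (Q x))" by (intro computable_intros)
  then show ?thesis by (simp only: of_bool_conj)
qed

lemma decidable_disj [computable_intros]:
  assumes [computable_intros]: "decidable A P" "decidable A Q"
  shows "decidable A (\<lambda>x. P x \<or> Q x)"
proof -
  have "decidable A (\<lambda>x. \<not> (\<not> P x \<and> \<not> Q x))" by (intro computable_intros)
  then show ?thesis by simp
qed

lemma decidable_imp [computable_intros]:
  assumes [computable_intros]: "decidable A P" "decidable A Q"
  shows "decidable A (\<lambda>x. P x \<longrightarrow> Q x)"
proof -
  have "decidable A (\<lambda>x. \<not> P x \<or> Q x)" by (intro computable_intros)
  then show ?thesis by (simp only: imp_conv_disj)
qed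

lemma decidable_iff [computable_intros]:
  assumes [computable_intros]: "decidable A P" "decidable A Q"
  shows "decidable A (\<lambda>x. P x \<longleftrightarrow> Q x)"
proof -
  have "decidable A (\<lambda>x. (P x \<longrightarrow> Q x) \<and> (Q x \<longrightarrow> P x))" by (intro computable_intros)
  then show ?thesis unfolding iff_conv_conj_imp .
qed

lemma decidable_le [computable_intros]:
  assumes [computable_intros]: "computable A f" "computable A g"
  shows "decidable A (\<lambda>x. f x \<le> g x)"
proof -
  have "computable A (\<lambda>x. 1 - (f x - g x))" by (intro computable_intros)
  moreover have "1 - (f x - g x) = of_bool (f x \<le> g x)" for x by auto
  ultimately show ?thesis by simp
qed

lemma decidable_less [computable_intros]:
  assumes [computable_intros]: "computable A f" "computable A g"
  shows "decidable A (\<lambda>x. f x < g x)"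
proof -
  have "decidable A (\<lambda>x. \<not> g x \<le> f x)" by (intro computable_intros)
  then show ?thesis by (simp only: not_le)
qed

lemma decidable_eq [computable_intros]:
  assumes [computable_intros]: "computable A f" "computable A g"
  shows "decidable A (\<lambda>x. f x = g x)"
proof -
  have "decidable A (\<lambda>x. f x \<le> g x \<and> g x \<le> f x)" by (intro computable_intros)
  then show ?thesis by (simp only: order_eq_iff)
qed

section \<open>Bounded sums and quantifiers, minimisation, division\<close>

lemma computable_sum [computable_intros]:
  assumes "computable2 A f" and [computable_intros]: "computable A n"
  shows "computable A (\<lambda>x. \<Sum>i<n x. f x i)"
proof -
  have "computable A (\<lambda>x. rec_nat 0 (\<lambda>k r. r + f x k) (n x))"
    by (intro computable_intros computable2_comp[OF assms(1)])
  moreover have "rec_nat 0 (\<lambda>k r. r + f x k) m = (\<Sum>i<m. f x i)" for m x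
    by (induction m) auto
  ultimately show ?thesis by simp
qed

lemma decidable_bex [computable_intros]:
  assumes [computable_intros]: "decidable A (\<lambda>x. P (pfst x) (psnd x))" "computable A n"
  shows "decidable A (\<lambda>x. \<exists>i<n x. P x i)"
proof -
  have "decidable A (\<lambda>x. 0 < (\<Sum>i<n x. of_bool (P x i) :: nat))"
    by (intro computable_intros)
  moreover have "0 < (\<Sum>i<n x. of_bool (P x i) :: nat) \<longleftrightarrow> (\<exists>i<n x. P x i)" for x
    by (auto simp: card_gt_0_iff)
  ultimately show ?thesis by simp
qed

text \<open>\<open>PMin\<close> searches for the value 0, so it is applied to the negation of
  \<open>P\<close>. A witness for every \<open>x\<close> makes the search total without any bound on
  the witness.\<close>

lemma computable_Least:
  assumes "decidable A (\<lambda>x. P (pfst x) (psnd x))" "\<And>x. \<exists>n. P x n"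
  shows "computable A (\<lambda>x. LEAST n. P x n)"
proof -
  have "decidable A (\<lambda>x. \<not> P (pfst x) (psnd x))"
    by (intro computable_intros assms)
  then obtain p where p: "\<And>x. runs A p x (of_bool (\<not> P (pfst x) (psnd x)))"
    unfolding computable_def by blast
  have "runs A (PMin p) x (LEAST n. P x n)" for x
  proof (rule runs.min)
    show "runs A p (prod_encode (x, LEAST n. P x n)) 0"
      using p[of "prod_encode (x, LEAST n. P x n)"] LeastI_ex[OF assms(2), of x] by simp
    show "\<forall>i<LEAST n. P x n. \<exists>y. runs A p (prod_encode (x, i)) (Suc y)"
    proof (intro allI impI)
      fix i assume "i < (LEAST n. P x n)"
      then have "\<not> P x i" by (rule not_less_Least)
      then show "\<exists>y. runs A p (prod_encode (x, i)) (Suc y)"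
        using p[of "prod_encode (x, i)"] by auto
    qed
  qed
  then show ?thesis unfolding computable_def by blast
qed

lemma decidable_odd [computable_intros]:
  assumes [computable_intros]: "computable A f"
  shows "decidable A (\<lambda>x. odd (f x))"
proof -
  \<comment> \<open>The bound is \<open>Suc (f x)\<close> so that \<open>i = 0\<close> is available
    when \<open>f x = 0\<close>.\<close>
  have "decidable A (\<lambda>x. \<not> (\<exists>i<Suc (f x). f x = 2 * i))"
    by (intro computable_intros computable_comp[OF assms])
  moreover have "(\<exists>i<Suc m. m = 2 * i) \<longleftrightarrow> even m" for m :: nat
    by (auto elim!: evenE)
  ultimately show ?thesis by simp
qed

lemma computable_div_power2 [computable_intros]:
  assumes [computable_intros]: "computable A f" "computable A g"
  shows "computable A (\<lambda>x. f x div 2 ^ g x)"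
proof -
  have "computable A (\<lambda>x. LEAST q. f x < Suc q * 2 ^ g x)"
  proof (intro computable_Least computable_intros computable_comp[OF assms(1)] computable_comp[OF assms(2)])
    fix x
    have "f x < Suc (f x) * 2 ^ g x"
      by (metis le_eq_less_or_eq less_Suc_eq_le mult.right_neutral mult_le_mono2 one_le_power one_le_numeral order_less_le_trans)
    then show "\<exists>q. f x < Suc q * 2 ^ g x" by blast
  qed
  moreover have "(LEAST q. a < Suc q * 2 ^ b) = a div 2 ^ b" for a b :: nat
  proof (rule Least_equality)
    show "a < Suc (a div 2 ^ b) * 2 ^ b"
      by (metis dividend_less_div_times mult.commute mult_Suc zero_less_numeral zero_less_power)
    show "a div 2 ^ b \<le> q" if "a < Suc q * 2 ^ b" for q
      using that by (simp add: div_less_iff_less_mult flip: less_Suc_eq_le)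
  qed
  ultimately show ?thesis by simp
qed

lemma computable_if [computable_intros]:
  assumes [computable_intros]: "decidable A P" "computable A f" "computable A g"
  shows "computable A (\<lambda>x. if P x then f x else g x)"
proof -
  have "computable A (\<lambda>x. of_bool (P x) * f x + of_bool (\<not> P x) * g x)"
    by (intro computable_intros)
  moreover have "of_bool (P x) * f x + of_bool (\<not> P x) * g x = (if P x then f x else g x)" for x
    by simp
  ultimately show ?thesis by simp
qed


section \<open>Lists and strings\<close>

lemma list_decode_comp: "computable A (\<lambda>x. list_encode (list_decode x))"
  by (simp add: computable_id)

lemma computable_tl [computable_intros]:
  assumes [computable_intros]: "computable A (\<lambda>x. list_encode (l x))"
  shows "computable A (\<lambda>x. list_encode (tl (l x)))"
proof -
  have "computable A (\<lambda>x. psnd (list_encode (l x) - 1))"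
    by (intro computable_intros)
  \<comment> \<open>On the empty list the truncated \<open>0 - 1\<close> is 0 again, and its second
    projection is 0, the code of the empty list.\<close>
  moreover have "prod_decode 0 = (0, 0)"
    by (simp add: prod_decode_def prod_decode_aux.simps)
  then have "psnd (list_encode xs - 1) = list_encode (tl xs)" for xs
    by (cases xs) auto
  ultimately show ?thesis by simp
qed

lemma computable_drop [computable_intros]:
  assumes [computable_intros]: "computable A (\<lambda>x. list_encode (l x))" "computable A n"
  shows "computable A (\<lambda>x. list_encode (drop (n x) (l x)))"
proof -
  have tl: "computable A (\<lambda>x. list_encode (tl (list_decode x)))"
    by (intro computable_intros list_decode_comp)
  have "computable A (\<lambda>x. rec_nat (list_encode (l x)) (\<lambda>_ r. list_encode (tl (list_decode r))) (n x))"
    by (intro computable_intros computable_comp[OF tl])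
  moreover have "rec_nat (list_encode xs) (\<lambda>_ r. list_encode (tl (list_decode r))) m
      = list_encode (drop m xs)" for m xs
    by (induction m) (auto simp: drop_Suc tl_drop)
  ultimately show ?thesis by simp
qed

lemma computable_length_list [computable_intros]:
  assumes "computable A (\<lambda>x. list_encode (l x))"
  shows "computable A (\<lambda>x. length (l x))"
proof -
  have z: "list_encode xs = 0 \<longleftrightarrow> xs = []" for xs by (cases xs) auto
  have "computable A (\<lambda>x. list_encode (list_decode x))" by (simp add: computable_id)
  from computable_drop[OF computable_comp[OF this computable_pfst] computable_psnd]
  have "computable A (\<lambda>x. LEAST n. list_encode (drop n (list_decode x)) = 0)"
    by (intro computable_Least computable_intros) (auto simp: z intro: computable_intros)
  moreover have "(LEAST n. list_encode (drop n xs) = 0) = length xs" for xs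
    by (intro Least_equality) (auto simp: z)
  ultimately have "computable A (\<lambda>x. length (list_decode x))" by simp
  from computable_comp[OF this assms] show ?thesis by simp
qed

text \<open>Beyond the end of a list \<open>!\<close> has no specified value, so a computable
  function is only claimed to agree with it on valid positions.\<close>

lemma computable_nth:
  assumes "computable A (\<lambda>x. list_encode (l x))" "computable A n"
  obtains f where "computable A f" "\<And>x. n x < length (l x) \<Longrightarrow> f x = l x ! n x"
proof
  show "computable A (\<lambda>x. pfst (list_encode (drop (n x) (l x)) - 1))"
    by (intro computable_intros assms)
  show "pfst (list_encode (drop (n x) (l x)) - 1) = l x ! n x" if "n x < length (l x)" for x
    using that by (simp add: Cons_nth_drop_Suc[symmetric])
qed

lemma computable_tabulate:
  assumes "computable2 A f" and [computable_intros]: "computable A n"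
  shows "computable A (\<lambda>x. list_encode (map (f x) [0..<n x]))"
proof -
  \<comment> \<open>Consing is the basic operation on codes, so the table is built backwards: after
    \<open>j\<close> steps it holds its last \<open>j\<close> entries.\<close>
  have "computable A (\<lambda>x. rec_nat 0 (\<lambda>k r. Suc (prod_encode (f x (n x - Suc k), r))) (n x))"
    by (intro computable_intros computable2_comp[OF assms(1)] computable_comp[OF assms(2)])
  moreover have "rec_nat 0 (\<lambda>k r. Suc (prod_encode (f x (m - Suc k), r))) j
      = list_encode (map (f x) [m - j..<m])" if "j \<le> m" for m x j
    using that
  proof (induction j)
    case (Suc j)
    then have "[m - Suc j..<m] = (m - Suc j) # [m - j..<m]"
      by (metis Suc_diff_Suc Suc_le_lessD diff_less less_le_trans upt_conv_Cons zero_less_Suc)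
    with Suc show ?case by simp
  qed simp
  ultimately show ?thesis by simp
qed

section \<open>Binary strings\<close>

text \<open>Any nonzero list entry is read as \<open>True\<close>, so that every number denotes a
  string although \<open>string_code\<close> is not surjective.\<close>

definition decode_string :: "nat \<Rightarrow> bool list" where
  "decode_string s = map (\<lambda>n. n \<noteq> 0) (list_decode s)"

lemma decode_string_code [simp]: "decode_string (string_code \<sigma>) = \<sigma>"
  by (simp add: decode_string_def string_code_def o_def)

lemma computable_length_string [computable_intros]:
  assumes "computable A (\<lambda>x. string_code (\<sigma> x))"
  shows "computable A (\<lambda>x. length (\<sigma> x))"
  using computable_length_list[of A "\<lambda>x. map of_bool (\<sigma> x)"] assms
  by (simp add: string_code_def)

lemma computable_string_tabulate:
  assumes "decidable A (\<lambda>x. P (pfst x) (psnd x))" "computable A n"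
  shows "computable A (\<lambda>x. string_code (map (P x) [0..<n x]))"
  using computable_tabulate[OF assms] by (simp add: string_code_def o_def)

lemma computable_rev [computable_intros]:
  assumes "computable A (\<lambda>x. list_encode (l x))"
  shows "computable A (\<lambda>x. list_encode (rev (l x)))"
proof -
  have len: "computable A (\<lambda>x. length (list_decode x))"
    by (intro computable_intros list_decode_comp)
  obtain f where f: "computable A f"
    "\<And>x. psnd x < length (list_decode (pfst x)) \<Longrightarrow> f x = list_decode (pfst x) ! psnd x"
    by (rule computable_nth[of A "\<lambda>x. list_decode (pfst x)" psnd]) (auto intro: computable_intros)
  have "computable A (\<lambda>x. list_encode (map
      (\<lambda>k. f (prod_encode (x, length (list_decode x) - Suc k))) [0..<length (list_decode x)]))"
    by (intro computable_tabulate computable_intros computable_comp[OF f(1)] computable_comp[OF len] len)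
  moreover have "map (\<lambda>k. f (prod_encode (x, length (list_decode x) - Suc k))) [0..<length (list_decode x)]
      = rev (list_decode x)" for x
    by (rule nth_equalityI) (auto simp: f(2) rev_nth)
  ultimately have "computable A (\<lambda>x. list_encode (rev (list_decode x)))" by simp
  from computable_comp[OF this assms] show ?thesis by simp
qed

lemma computable_take_decode_string:
  assumes "computable A n" "computable A s"
  shows "computable A (\<lambda>x. string_code (take (n x) (decode_string (s x))))"
proof -
  have len: "computable A (\<lambda>x. length (list_decode x))"
    by (intro computable_intros list_decode_comp)
  obtain f where f: "computable A f"
    "\<And>x. psnd x < length (list_decode (pfst x)) \<Longrightarrow> f x = list_decode (pfst x) ! psnd x"
    by (rule computable_nth[of A "\<lambda>x. list_decode (pfst x)" psnd]) (auto intro: computable_intros)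
  define m where "m x = (if pfst x \<le> length (list_decode (psnd x)) then pfst x
      else length (list_decode (psnd x)))" for x
  have "computable A (\<lambda>x. string_code (map (\<lambda>k. f (prod_encode (psnd x, k)) \<noteq> 0) [0..<m x]))"
    unfolding m_def
    by (intro computable_string_tabulate computable_intros computable_comp[OF f(1)] computable_comp[OF len])
  moreover have "map (\<lambda>k. f (prod_encode (psnd x, k)) \<noteq> 0) [0..<m x]
      = take (pfst x) (decode_string (psnd x))" for x
    by (rule nth_equalityI) (auto simp: f(2) m_def decode_string_def split: if_splits)
  ultimately have "computable2 A (\<lambda>n s. string_code (take n (decode_string s)))" by simp
  from computable2_comp[OF this assms] show ?thesis .
qed

lemma computable_take_string [computable_intros]:
  assumes "computable A n" "computable A (\<lambda>x. string_code (\<sigma> x))"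
  shows "computable A (\<lambda>x. string_code (take (n x) (\<sigma> x)))"
  using computable_take_decode_string[OF assms] by simp

lemma computable_decode_string [computable_intros]:
  assumes "computable A s"
  shows "computable A (\<lambda>x. string_code (decode_string (s x)))"
proof -
  have len: "computable A (\<lambda>x. length (list_decode x))"
    by (intro computable_intros list_decode_comp)
  from computable_take_decode_string[OF computable_comp[OF len assms] assms]
  show ?thesis by (simp add: decode_string_def)
qed

text \<open>The low \<open>l\<close> binary digits of \<open>v\<close>, least significant first. For
  \<open>v < 2 ^ l\<close> they enumerate the strings of length \<open>l\<close>, which turns
  counting strings into a bounded sum.\<close>

definition bits :: "nat \<Rightarrow> nat \<Rightarrow> bool list" where
  "bits l v = map (\<lambda>k. odd (v div 2 ^ k)) [0..<l]"

lemma computable_bits [computable_intros]: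
  assumes "computable A l" "computable A v"
  shows "computable A (\<lambda>x. string_code (bits (l x) (v x)))"
  unfolding bits_def
  by (intro computable_string_tabulate computable_intros computable_comp[OF assms(2)] assms(1))


section \<open>The Turing jump\<close>

inductive_cases runs_PZeroE: "runs A PZero x y"
inductive_cases runs_PSuccE: "runs A PSucc x y"
inductive_cases runs_PFstE: "runs A PFst x y"
inductive_cases runs_PSndE: "runs A PSnd x y"
inductive_cases runs_POracleE: "runs A POracle x y"
inductive_cases runs_PPairE: "runs A (PPair p q) x y"
inductive_cases runs_PCompE: "runs A (PComp p q) x y"
inductive_cases runs_PRecE: "runs A (PRec p q) x y"
inductive_cases runs_PMinE: "runs A (PMin p) x y"

text \<open>For \<open>PMin\<close>, if two results differed, the inner program would yield both 0
  and a successor at the smaller one.\<close>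

lemma runs_deterministic:
  assumes "runs A p x y" "runs A p x z"
  shows "y = z"
  using assms
proof (induction arbitrary: z rule: runs.induct)
  case (rec_0 p a y q)
  from rec_0.prems rec_0.IH show ?case by (auto elim: runs_PRecE)
next
  case (rec_Suc p q a n y z)
  from rec_Suc.prems obtain w where "runs A (PRec p q) (prod_encode (a, n)) w"
    "runs A q (prod_encode (a, prod_encode (n, w))) z"
    by (auto elim: runs_PRecE)
  with rec_Suc.IH show ?case by metis
next
  case (min p a n)
  from \<open>runs A (PMin p) a z\<close> obtain
    z: "runs A p (prod_encode (a, z)) 0" "\<forall>i<z. \<exists>y. runs A p (prod_encode (a, i)) (Suc y)"
    by (auto elim: runs_PMinE)
  show ?case
  proof (cases n z rule: linorder_cases)
    case less
    with z(2) min.IH(1) show ?thesis by (metis nat.distinct(1))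
  next
    case greater
    with min.IH(2) z(1) show ?thesis by (metis nat.distinct(1))
  qed
next
  case (pair p x y q z')
  from pair.prems obtain u v where "runs A p x u" "runs A q x v" "z = prod_encode (u, v)"
    by (auto elim: runs_PPairE)
  with pair.IH show ?case by metis
next
  case (comp q x y p z')
  from comp.prems obtain u where "runs A q x u" "runs A p u z"
    by (auto elim: runs_PCompE)
  with comp.IH show ?case by metis
qed (auto elim: runs_PZeroE runs_PSuccE runs_PFstE runs_PSndE runs_POracleE)

section \<open>Deciding halting with the jump\<close>

lemma goedel_inject: "goedel p = goedel q \<longleftrightarrow> p = q"
proof
  show "goedel p = goedel q \<Longrightarrow> p = q"
    by (induction p arbitrary: q; case_tac q) auto
qed simp

fun constant_prog :: "nat \<Rightarrow> prog" where
  "constant_prog 0 = PZero"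
| "constant_prog (Suc n) = PComp PSucc (constant_prog n)"

lemma runs_constant_prog: "runs A (constant_prog n) x y \<longleftrightarrow> y = n"
proof (induction n arbitrary: y)
  case 0
  show ?case by (auto elim: runs_PZeroE intro: runs.zero)
next
  case (Suc n)
  then show ?case
    by (auto elim!: runs_PCompE runs_PSuccE intro: runs.comp runs.succ)
qed

lemma computable_goedel_constant_prog: "computable A (\<lambda>n. goedel (constant_prog n))"
proof -
  have "computable A (\<lambda>n. rec_nat (goedel PZero)
      (\<lambda>_ r. prod_encode (6, prod_encode (goedel PSucc, r))) n)"
    by (intro computable_intros)
  moreover have "rec_nat (goedel PZero) (\<lambda>_ r. prod_encode (6, prod_encode (goedel PSucc, r))) n
      = goedel (constant_prog n)" for n
    by (induction n) auto
  ultimately show ?thesis by simp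
qed

text \<open>\<open>jump\<close> only answers whether a program halts on its own index.
  \<open>PComp p (constant_prog x)\<close> disregards its input and runs \<open>p\<close> on
  \<open>x\<close>, and its index is computable from \<open>x\<close>, so one query settles the
  question.\<close>

lemma decidable_jump_halts: "decidable (jump A) (\<lambda>x. \<exists>y. runs A p x y)"
proof -
  let ?q = "\<lambda>x. PComp p (constant_prog x)"
  have "computable (jump A) (\<lambda>x. prod_encode (6, prod_encode (goedel p, goedel (constant_prog x))))"
    by (intro computable_intros computable_goedel_constant_prog)
  then have "computable (jump A) (\<lambda>x. goedel (?q x))"
    by simp
  from decidable_oracle[OF this] have "decidable (jump A) (\<lambda>x. goedel (?q x) \<in> jump A)" .
  moreover have "goedel (?q x) \<in> jump A \<longleftrightarrow> (\<exists>y. runs A p x y)" for x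
  proof -
    have "goedel (?q x) \<in> jump A \<longleftrightarrow> (\<exists>y. runs A (?q x) (goedel (?q x)) y)"
      unfolding jump_def by (auto simp: goedel_inject simp del: goedel.simps)
    also have "\<dots> \<longleftrightarrow> (\<exists>y. runs A p x y)"
      by (auto elim!: runs_PCompE intro!: runs.comp simp: runs_constant_prog)
    finally show ?thesis .
  qed
  ultimately show ?thesis by simp
qed

text \<open>\<open>PMin\<close> searches for a witness and halts exactly when there is one.
  Existential quantifiers over decidable relations thereby become halting questions.\<close>

lemma halts_iff_ex:
  assumes "decidable A (\<lambda>x. P (pfst x) (psnd x))"
  shows "\<exists>p. \<forall>x. (\<exists>y. runs A p x y) \<longleftrightarrow> (\<exists>n. P x n)"
proof -
  have "decidable A (\<lambda>x. \<not> P (pfst x) (psnd x))"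
    by (intro computable_intros assms)
  then obtain p where "\<And>x. runs A p x (of_bool (\<not> P (pfst x) (psnd x)))"
    unfolding computable_def by blast
  then have p: "runs A p (prod_encode (x, n)) (of_bool (\<not> P x n))" for x n
    by (metis fst_conv snd_conv prod_encode_inverse)
  have "(\<exists>y. runs A (PMin p) x y) \<longleftrightarrow> (\<exists>n. P x n)" for x
  proof
    assume "\<exists>y. runs A (PMin p) x y"
    then obtain n where "runs A p (prod_encode (x, n)) 0"
      by (auto elim: runs_PMinE)
    from runs_deterministic[OF this p] show "\<exists>n. P x n"
      by (auto split: if_splits simp: of_bool_def)
  next
    assume ex: "\<exists>n. P x n"
    have "runs A (PMin p) x (LEAST n. P x n)"
    proof (rule runs.min)
      show "runs A p (prod_encode (x, LEAST n. P x n)) 0"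
        using p[of x "LEAST n. P x n"] LeastI_ex[OF ex] by simp
      show "\<forall>i<LEAST n. P x n. \<exists>y. runs A p (prod_encode (x, i)) (Suc y)"
        using p[of x] not_less_Least[of _ "P x"] by (metis (full_types) One_nat_def of_bool_eq(2))
    qed
    then show "\<exists>y. runs A (PMin p) x y" by blast
  qed
  then show ?thesis by blast
qed

lemma decidable_jump_ex:
  assumes "decidable A (\<lambda>x. P (pfst x) (psnd x))"
  shows "decidable (jump A) (\<lambda>x. \<exists>n. P x n)"
proof -
  obtain p where "\<And>x. (\<exists>y. runs A p x y) \<longleftrightarrow> (\<exists>n. P x n)"
    using halts_iff_ex[OF assms] by blast
  with decidable_jump_halts[of A p] show ?thesis by simp
qed

section \<open>Oracle substitution and c.e. sets\<close>

primrec replace_oracle :: "prog \<Rightarrow> prog \<Rightarrow> prog" where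
  "replace_oracle q PZero = PZero"
| "replace_oracle q PSucc = PSucc"
| "replace_oracle q PFst = PFst"
| "replace_oracle q PSnd = PSnd"
| "replace_oracle q POracle = q"
| "replace_oracle q (PPair p p') = PPair (replace_oracle q p) (replace_oracle q p')"
| "replace_oracle q (PComp p p') = PComp (replace_oracle q p) (replace_oracle q p')"
| "replace_oracle q (PRec p p') = PRec (replace_oracle q p) (replace_oracle q p')"
| "replace_oracle q (PMin p) = PMin (replace_oracle q p)"

lemma runs_replace_oracle:
  assumes "\<And>x. runs B q x (of_bool (x \<in> A))" "runs A p x y"
  shows "runs B (replace_oracle q p) x y"
  using assms(2)
proof induction
  case (query x)
  show ?case using assms(1) by simp
qed (auto intro: runs.intros)

lemma computable_jump:
  assumes "computable A f"
  shows "computable (jump A) f"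
proof -
  \<comment> \<open>A vacuous quantifier makes membership in \<open>A\<close> an instance of
    \<open>decidable_jump_ex\<close>, so \<open>jump A\<close> decides \<open>A\<close>.\<close>
  have "decidable (jump A) (\<lambda>x. \<exists>n::nat. x \<in> A)"
    by (intro decidable_jump_ex computable_intros)
  then obtain q where "\<And>x. runs (jump A) q x (of_bool (x \<in> A))"
    unfolding computable_def by auto
  from runs_replace_oracle[OF this] assms show ?thesis
    unfolding computable_def by blast
qed

lemma ce_in_decidable:
  assumes "decidable A (\<lambda>x. x \<in> W)"
  shows "ce_in A W"
proof -
  have "decidable A (\<lambda>x. pfst x \<in> W)"
    using computable_comp[OF assms computable_pfst[OF computable_id]] .
  then obtain p where "\<And>x. (\<exists>y. runs A p x y) \<longleftrightarrow> (\<exists>n::nat. x \<in> W)"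
    using halts_iff_ex[of A "\<lambda>x _. x \<in> W"] by blast
  then show ?thesis
    unfolding ce_in_def by (intro exI[of _ p]) auto
qed

lemma countable_prog: "countable (UNIV :: prog set)"
  by (rule countableI[of goedel]) (simp add: inj_on_def goedel_inject)


section \<open>The uniform measure\<close>

abbreviation "\<mu> \<equiv> uniform_measure_cantor"

interpretation cantor: product_prob_space "\<lambda>_::nat. measure_pmf (bernoulli_pmf (1/2))" UNIV
  by unfold_locales

interpretation \<mu>: prob_space \<mu>
  unfolding uniform_measure_cantor_def by (rule cantor.P.prob_space_axioms)

lemma space_\<mu> [simp]: "space \<mu> = UNIV"
  by (simp add: uniform_measure_cantor_def space_PiM)

lemma length_init_seg [simp]: "length (init_seg Z n) = n"
  by (simp add: init_seg_def)

lemma take_init_seg [simp]: "take k (init_seg Z n) = init_seg Z (min k n)"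
  by (simp add: init_seg_def take_map min_def)

section \<open>Cylinders and measures of clopen sets\<close>

lemma cylinder_eq: "cylinder \<sigma> = {Z. \<forall>i<length \<sigma>. Z i = \<sigma> ! i}"
proof -
  have "init_seg Z (length \<sigma>) = \<sigma> \<longleftrightarrow> (\<forall>i<length \<sigma>. Z i = \<sigma> ! i)" for Z
    unfolding list_eq_iff_nth_eq by (simp add: init_seg_def)
  then show ?thesis by (simp only: cylinder_def)
qed

lemma cylinder_PiM: "cylinder \<sigma> = prod_emb UNIV (\<lambda>_. measure_pmf (bernoulli_pmf (1/2)))
    {..<length \<sigma>} (Pi\<^sub>E {..<length \<sigma>} (\<lambda>i. {\<sigma> ! i}))"
  by (auto simp: cylinder_eq prod_emb_def space_PiM PiE_def extensional_def restrict_def Pi_def)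

lemma sets_cylinder [measurable]: "cylinder \<sigma> \<in> sets \<mu>"
  unfolding cylinder_PiM uniform_measure_cantor_def by (rule sets_PiM_I) auto

lemma measure_cylinder: "measure \<mu> (cylinder \<sigma>) = (1/2) ^ length \<sigma>"
proof -
  have "measure \<mu> (cylinder \<sigma>)
      = (\<Prod>i<length \<sigma>. measure (measure_pmf (bernoulli_pmf (1/2))) {\<sigma> ! i})"
    unfolding cylinder_PiM uniform_measure_cantor_def by (rule cantor.measure_PiM_emb) auto
  also have "\<dots> = (\<Prod>i<length \<sigma>. 1/2)"
    by (intro prod.cong refl) (metis (full_types) bernoulli_pmf_half_conv_pmf_of_set measure_pmf_single pmf_bernoulli_half)
  finally show ?thesis by simp
qed

lemma Collect_init_seg: "{Z. Q (init_seg Z n)} = (\<Union>\<sigma>\<in>{\<sigma>. length \<sigma> = n \<and> Q \<sigma>}. cylinder \<sigma>)"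
  by (auto simp: cylinder_def)

lemma finite_strings: "finite {\<sigma> :: bool list. length \<sigma> = n}"
  using finite_lists_length_eq[of "UNIV :: bool set" n] by simp

lemma sets_init_seg [measurable]: "{Z. Q (init_seg Z n)} \<in> sets \<mu>"
  unfolding Collect_init_seg
  by (intro sets.finite_UN) (auto intro: finite_subset[OF _ finite_strings])

lemma bij_betw_bits: "bij_betw (bits l) {..<2 ^ l} {\<sigma>. length \<sigma> = l}"
proof -
  have inj: "inj_on (bits l) {..<2 ^ l}"
  proof (rule inj_onI)
    fix v v' :: nat
    assume v: "v \<in> {..<2 ^ l}" "v' \<in> {..<2 ^ l}" and eq: "bits l v = bits l v'"
    have "bit v k = bit v' k" if "k < l" for k
      using arg_cong[OF eq, of "\<lambda>xs. xs ! k"] that by (simp add: bits_def bit_iff_odd)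
    then have "take_bit l v = take_bit l v'"
      by (intro bit_eqI) (auto simp: bit_take_bit_iff)
    with v show "v = v'" by (simp add: take_bit_nat_eq_self)
  qed
  have "bits l ` {..<2 ^ l} \<subseteq> {\<sigma>. length \<sigma> = l}" by (auto simp: bits_def)
  moreover have "card (bits l ` {..<2 ^ l}) = card {\<sigma> :: bool list. length \<sigma> = l}"
    using card_lists_length_eq[of "UNIV :: bool set" l] by (simp add: card_image[OF inj])
  ultimately have "bits l ` {..<2 ^ l} = {\<sigma>. length \<sigma> = l}"
    by (intro card_subset_eq finite_strings)
  with inj show ?thesis by (simp add: bij_betw_def)
qed

text \<open>The strings of length \<open>l\<close> are the \<open>bits l v\<close>, each with a
  cylinder of measure \<open>(1/2) ^ l\<close>. For decidable \<open>Q\<close> the numerator is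
  computable, so measures of clopen sets can be compared effectively.\<close>

lemma measure_init_seg:
  "measure \<mu> {Z. Q (init_seg Z l)} = real (\<Sum>v<2 ^ l. of_bool (Q (bits l v))) / 2 ^ l"
proof -
  let ?S = "{\<sigma>. length \<sigma> = l \<and> Q \<sigma>}"
  have fin: "finite ?S" by (rule finite_subset[OF _ finite_strings[of l]]) auto
  have "measure \<mu> {Z. Q (init_seg Z l)} = (\<Sum>\<sigma>\<in>?S. measure \<mu> (cylinder \<sigma>))"
    unfolding Collect_init_seg
    by (intro \<mu>.finite_measure_finite_Union fin) (auto simp: disjoint_family_on_def cylinder_def)
  also have "\<dots> = (\<Sum>\<sigma> | length \<sigma> = l. of_bool (Q \<sigma>) * (1/2) ^ l)"
    by (rule sum.mono_neutral_cong_left[OF finite_strings]) (auto simp: measure_cylinder)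
  also have "\<dots> = (\<Sum>v<2 ^ l. of_bool (Q (bits l v)) * (1/2) ^ l)"
    by (rule sum.reindex_bij_betw[OF bij_betw_bits, symmetric])
  also have "\<dots> = real (\<Sum>v<2 ^ l. of_bool (Q (bits l v))) / 2 ^ l"
    by (simp add: power_one_over flip: sum_divide_distrib)
  finally show ?thesis .
qed

section \<open>Local measure and lower density\<close>

lemma local_measure_le_1: "local_measure \<sigma> C \<le> 1"
proof -
  have "measure \<mu> (C \<inter> cylinder \<sigma>) \<le> (1/2) ^ length \<sigma>"
    unfolding measure_cylinder[symmetric] by (rule \<mu>.finite_measure_mono) auto
  then have "local_measure \<sigma> C \<le> 2 ^ length \<sigma> * (1/2) ^ length \<sigma>"
    unfolding local_measure_def by (intro mult_left_mono) auto
  then show ?thesis by (simp add: power_one_over)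
qed

lemma lower_density_le_1: "lower_density C Z \<le> 1"
proof -
  have "lower_density C Z \<le> liminf (\<lambda>n. 1 :: ereal)"
    unfolding lower_density_def
    by (intro Liminf_mono always_eventually) (simp add: local_measure_le_1)
  then show ?thesis by (simp add: Liminf_const)
qed

lemma lower_density_mono:
  assumes "AE Z in \<mu>. Z \<in> C \<longrightarrow> Z \<in> D" "D \<in> sets \<mu>"
  shows "lower_density C Z \<le> lower_density D Z"
  unfolding lower_density_def local_measure_def
proof (intro Liminf_mono always_eventually allI)
  fix n
  have "measure \<mu> (C \<inter> cylinder (init_seg Z n)) \<le> measure \<mu> (D \<inter> cylinder (init_seg Z n))"
    using assms by (intro \<mu>.finite_measure_mono_AE) auto
  then show "ereal (2 ^ length (init_seg Z n) * measure \<mu> (C \<inter> cylinder (init_seg Z n)))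
      \<le> ereal (2 ^ length (init_seg Z n) * measure \<mu> (D \<inter> cylinder (init_seg Z n)))"
    by simp
qed

section \<open>Borel-Cantelli estimates\<close>

lemma measure_Union_geometric:
  assumes "\<And>i. F i \<in> sets \<mu>" "\<And>i. measure \<mu> (F i) \<le> c * (1/2) ^ i"
  shows "measure \<mu> (\<Union>i. F i) \<le> 2 * c"
proof -
  have sums: "(\<lambda>i. c * (1/2 :: real) ^ i) sums (c * 2)"
    using sums_mult[OF geometric_sums[of "1/2 :: real"], of c] by simp
  have summable: "summable (\<lambda>i. measure \<mu> (F i))"
    using assms(2) by (intro summable_comparison_test[OF _ sums_summable[OF sums]]) auto
  have "measure \<mu> (\<Union>i. F i) \<le> (\<Sum>i. measure \<mu> (F i))"
    using assms(1) summable by (intro \<mu>.finite_measure_subadditive_countably) auto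
  also have "\<dots> \<le> c * 2"
    using suminf_le[OF assms(2) summable sums_summable[OF sums]] sums_unique[OF sums] by simp
  finally show ?thesis by simp
qed

text \<open>Summing over \<open>i\<close> from \<open>m + 2\<close> on and then over
  \<open>w\<close> costs a factor 2 each time; the offset 2 absorbs both.\<close>

lemma measure_tail:
  assumes "\<And>w i. F w i \<in> sets \<mu>" "\<And>w i. measure \<mu> (F w i) \<le> (1/2) ^ (w + i)"
  shows "measure \<mu> (\<Union>w. \<Union>i\<in>{m + 2..}. F w i) \<le> (1/2) ^ m"
proof -
  have atLeast: "(\<Union>i\<in>{m + 2..}. F w i) = (\<Union>i. F w (m + 2 + i))" for w
  proof -
    have "{m + 2..} = range (\<lambda>i. m + 2 + i)" by (auto simp: le_iff_add)
    then show ?thesis by auto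
  qed
  have "measure \<mu> (\<Union>i\<in>{m + 2..}. F w i) \<le> (1/2) ^ Suc m * (1/2) ^ w" for w
  proof -
    have "measure \<mu> (\<Union>i. F w (m + 2 + i)) \<le> 2 * ((1/2) ^ (w + m + 2))"
      using assms(2)[of w "m + 2 + _"] assms(1)
      by (intro measure_Union_geometric) (auto simp: power_add mult_ac)
    also have "\<dots> = (1/2) ^ Suc m * (1/2) ^ w" by (simp add: power_add)
    finally show ?thesis unfolding atLeast .
  qed
  then have "measure \<mu> (\<Union>w. \<Union>i\<in>{m + 2..}. F w i) \<le> 2 * (1/2) ^ Suc m"
    using assms(1) by (intro measure_Union_geometric) auto
  then show ?thesis by simp
qed

text \<open>Borel-Cantelli, uniformly in \<open>w\<close>: the tails for all \<open>w\<close> are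
  united before intersecting over \<open>m\<close>, so one \<open>m\<close> serves every
  \<open>w\<close>.\<close>

lemma AE_not_in_tail:
  assumes "\<And>w i. F w i \<in> sets \<mu>" "\<And>w i. measure \<mu> (F w i) \<le> (1/2) ^ (w + i)"
  shows "AE Z in \<mu>. \<exists>m. \<forall>w. \<forall>i\<ge>m. Z \<notin> F w i"
proof -
  let ?N = "\<Inter>m. \<Union>w. \<Union>i\<in>{m + 2..}. F w i"
  have N: "?N \<in> sets \<mu>" using assms(1) by auto
  have "measure \<mu> ?N \<le> (1/2) ^ m" for m
  proof -
    have "measure \<mu> ?N \<le> measure \<mu> (\<Union>w. \<Union>i\<in>{m + 2..}. F w i)"
      using assms(1) by (intro \<mu>.finite_measure_mono) auto
    also have "\<dots> \<le> (1/2) ^ m" by (rule measure_tail[OF assms])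
    finally show ?thesis .
  qed
  moreover have "(\<lambda>m. (1/2 :: real) ^ m) \<longlonglongrightarrow> 0" by (rule LIMSEQ_power_zero) simp
  ultimately have "measure \<mu> ?N \<le> 0" by (intro LIMSEQ_le_const) auto
  then have "measure \<mu> ?N = 0" by (simp add: antisym)
  then have "?N \<in> null_sets \<mu>" using N by (simp add: null_setsI \<mu>.emeasure_eq_measure)
  from AE_not_in[OF this] show ?thesis
  proof eventually_elim
    case (elim Z)
    then obtain m where "\<And>w i. i \<ge> m + 2 \<Longrightarrow> Z \<notin> F w i" by auto
    then show ?case by blast
  qed
qed

text \<open>Continuity from above: the sets \<open>H m\<close> of points at which two stages from
  \<open>m\<close> on disagree decrease to a null set.\<close>

lemma AE_stable_imp_Cauchy:
  fixes E :: "nat \<Rightarrow> cantor \<Rightarrow> bool"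
  assumes E: "\<And>t. {Z. E t Z} \<in> sets \<mu>"
    and stable: "AE Z in \<mu>. \<exists>m. \<forall>t\<ge>m. E t Z = E m Z" and "0 < e"
  shows "\<exists>m. \<forall>t\<ge>m. \<forall>t'\<ge>m. measure \<mu> {Z. E t Z \<noteq> E t' Z} \<le> e"
proof -
  have diff: "{Z. E t Z \<noteq> E t' Z} \<in> sets \<mu>" for t t'
  proof -
    have "{Z. E t Z \<noteq> E t' Z} = ({Z. E t Z} - {Z. E t' Z}) \<union> ({Z. E t' Z} - {Z. E t Z})" by auto
    then show ?thesis using E by auto
  qed
  define H where "H m = (\<Union>t\<in>{m..}. \<Union>t'\<in>{m..}. {Z. E t Z \<noteq> E t' Z})" for m
  have H: "H m \<in> sets \<mu>" for m unfolding H_def by (intro sets.countable_UN'' diff countableI_type)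
  have "decseq H" unfolding H_def decseq_def by (intro allI impI UN_mono) auto
  then have "(\<lambda>m. measure \<mu> (H m)) \<longlonglongrightarrow> measure \<mu> (\<Inter>m. H m)"
    using H by (intro \<mu>.finite_Lim_measure_decseq) auto
  moreover have "AE Z in \<mu>. Z \<notin> (\<Inter>m. H m)"
    using stable
  proof eventually_elim
    case (elim Z)
    then obtain m where m: "\<And>t. t \<ge> m \<Longrightarrow> E t Z = E m Z" by blast
    have "E t Z = E t' Z" if "t \<ge> m" "t' \<ge> m" for t t'
      by (rule trans[OF m[OF that(1)] m[OF that(2), symmetric]])
    then have "Z \<notin> H m" unfolding H_def by blast
    then show ?case by blast
  qed
  then have "measure \<mu> (\<Inter>m. H m) = 0"
    using H by (intro measure_eq_0_null_sets) (auto simp: AE_iff_null_sets)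
  ultimately have "\<forall>\<^sub>F m in sequentially. measure \<mu> (H m) < e"
    using \<open>0 < e\<close> by (auto dest: order_tendstoD(2))
  then obtain m where m: "measure \<mu> (H m) < e" by (auto simp: eventually_sequentially)
  have "measure \<mu> {Z. E t Z \<noteq> E t' Z} \<le> e" if "t \<ge> m" "t' \<ge> m" for t t'
  proof -
    have "measure \<mu> {Z. E t Z \<noteq> E t' Z} \<le> measure \<mu> (H m)"
      using that H by (intro \<mu>.finite_measure_mono) (auto simp: H_def)
    with m show ?thesis by simp
  qed
  then show ?thesis by blast
qed


section \<open>Clopen approximations\<close>

definition approx_holds ::
    "(nat \<Rightarrow> nat \<Rightarrow> nat) \<Rightarrow> (nat \<Rightarrow> nat \<Rightarrow> bool list \<Rightarrow> bool) \<Rightarrow> nat \<Rightarrow> nat \<Rightarrow> cantor \<Rightarrow> bool" where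
  "approx_holds l d w i Z \<longleftrightarrow> d w i (init_seg Z (l w i))"

text \<open>\<open>w\<close> names the set and \<open>i\<close> the stage of its approximation. The
  last clause allows \<open>d\<close> to be evaluated on any string of length at least
  \<open>l w i\<close>, so that two stages can be compared on a common prefix.\<close>

definition clopen_family ::
    "nat set \<Rightarrow> (nat \<Rightarrow> nat \<Rightarrow> nat) \<Rightarrow> (nat \<Rightarrow> nat \<Rightarrow> bool list \<Rightarrow> bool) \<Rightarrow> bool" where
  "clopen_family A l d \<longleftrightarrow> computable2 A l \<and>
    decidable A (\<lambda>x. d (pfst x) (pfst (psnd x)) (decode_string (psnd (psnd x)))) \<and>
    (\<forall>w i \<sigma>. l w i \<le> length \<sigma> \<longrightarrow> d w i (take (l w i) \<sigma>) = d w i \<sigma>)"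

text \<open>The exponent \<open>w + i\<close> makes the errors summable over both indices, so that a
  single Martin-Loef test handles all \<open>w\<close>.\<close>

definition fast_Cauchy ::
    "(nat \<Rightarrow> nat \<Rightarrow> nat) \<Rightarrow> (nat \<Rightarrow> nat \<Rightarrow> bool list \<Rightarrow> bool) \<Rightarrow> bool" where
  "fast_Cauchy l d \<longleftrightarrow> (\<forall>w i. measure \<mu>
    {Z. approx_holds l d w i Z \<noteq> approx_holds l d w (Suc i) Z} \<le> (1/2) ^ (w + i))"

text \<open>The stage \<open>m\<close> is chosen before \<open>w\<close>. This uniformity carries
  the argument through infinite unions and gives the final effectively closed class.\<close>

definition stabilizing :: "nat set \<Rightarrow> cantor \<Rightarrow> bool" where
  "stabilizing A Z \<longleftrightarrow> (\<forall>l d. clopen_family A l d \<and> fast_Cauchy l d \<longrightarrow>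
    (\<exists>m. \<forall>w. \<forall>i\<ge>m. approx_holds l d w i Z = approx_holds l d w m Z))"

text \<open>The limit is identified at every stabilizing point, not just almost everywhere, because
  the truth value at the given random point has to be followed.\<close>

definition approximable :: "nat set \<Rightarrow> (nat \<Rightarrow> cantor \<Rightarrow> bool) \<Rightarrow> bool" where
  "approximable A G \<longleftrightarrow> (\<exists>l d. clopen_family A l d \<and> fast_Cauchy l d \<and>
    (\<forall>Z. stabilizing A Z \<longrightarrow> (\<forall>w. \<exists>m. \<forall>i\<ge>m. approx_holds l d w i Z = G w Z)))"

lemma decidable_clopen_family:
  assumes "clopen_family A l d"
    and "computable A w" "computable A i" "computable A (\<lambda>x. string_code (\<sigma> x))"
  shows "decidable A (\<lambda>x. d (w x) (i x) (\<sigma> x))"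
proof -
  have "decidable A (\<lambda>x. d (pfst x) (pfst (psnd x)) (decode_string (psnd (psnd x))))"
    using assms(1) by (simp add: clopen_family_def)
  from computable_comp[OF this computable_prod_encode[OF assms(2) computable_prod_encode[OF assms(3,4)]]]
  show ?thesis by simp
qed

lemma computable_clopen_family:
  assumes "clopen_family A l d" "computable A w" "computable A i"
  shows "computable A (\<lambda>x. l (w x) (i x))"
proof (rule computable2_comp[OF _ assms(2,3)])
  show "computable2 A l" using assms(1) by (simp add: clopen_family_def)
qed

lemma approx_holds_init_seg:
  assumes "clopen_family A l d" "l w i \<le> n"
  shows "approx_holds l d w i Z = d w i (init_seg Z n)"
proof -
  have "d w i (take (l w i) (init_seg Z n)) = d w i (init_seg Z n)"
    using assms unfolding clopen_family_def by (metis length_init_seg)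
  then show ?thesis using assms(2) by (simp add: approx_holds_def min_absorb1)
qed

lemma sets_approx_holds: "{Z. approx_holds l d w i Z} \<in> sets \<mu>"
  unfolding approx_holds_def by (rule sets_init_seg)

lemma sets_approx_holds_neq: "{Z. approx_holds l d w i Z \<noteq> approx_holds l d w j Z} \<in> sets \<mu>"
proof -
  have "{Z. approx_holds l d w i Z \<noteq> approx_holds l d w j Z}
      = ({Z. approx_holds l d w i Z} - {Z. approx_holds l d w j Z})
        \<union> ({Z. approx_holds l d w j Z} - {Z. approx_holds l d w i Z})" by auto
  then show ?thesis using sets_approx_holds by auto
qed

lemma clopen_family_jump: "clopen_family A l d \<Longrightarrow> clopen_family (jump A) l d"
  unfolding clopen_family_def using computable_jump by blast

lemma stabilizing_jump: "stabilizing (jump A) Z \<Longrightarrow> stabilizing A Z"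
  unfolding stabilizing_def using clopen_family_jump by blast

section \<open>Martin-Loef random points and almost all points stabilize\<close>

lemma eventually_constant:
  assumes "\<And>i. i \<ge> m \<Longrightarrow> P i \<longleftrightarrow> P (Suc i)" "i \<ge> m"
  shows "P i \<longleftrightarrow> P m"
  using assms(2)
proof (induction rule: dec_induct)
  case (step n)
  from step.IH assms(1)[OF step.hyps(1)] show ?case by simp
qed simp

text \<open>A string \<open>\<sigma>\<close> stands for the pair \<open>(w, i)\<close> coded in its length, so that a single string
  predicate enumerates all the differences of consecutive approximations.\<close>

lemma ml_random_imp_stabilizing:
  assumes "ml_random_in A Z"
  shows "stabilizing A Z"
  unfolding stabilizing_def
proof (intro allI impI, elim conjE)
  fix l d assume fam: "clopen_family A l d" and fast: "fast_Cauchy l d"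
  \<comment> \<open>Component \<open>m\<close> collects only the stages from \<open>m + 2\<close>
    on, the offset that \<open>measure_tail\<close> requires.\<close>
  define W where "W = {x. \<exists>\<sigma> w i. \<sigma> = decode_string (psnd x) \<and> w = pfst (length \<sigma>) \<and>
    i = pfst (psnd (length \<sigma>)) \<and> pfst x + 2 \<le> i \<and> l w i \<le> length \<sigma> \<and> l w (Suc i) \<le> length \<sigma> \<and>
    \<not> (d w i \<sigma> \<longleftrightarrow> d w (Suc i) \<sigma>)}"
  let ?F = "\<lambda>w i. {Z. approx_holds l d w i Z \<noteq> approx_holds l d w (Suc i) Z}"
  have "decidable A (\<lambda>x. x \<in> W)"
    unfolding W_def mem_Collect_eq simp_thms ex_simps
    by (intro computable_intros computable_clopen_family[OF fam] decidable_clopen_family[OF fam])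
  then have ce: "ce_in A W" by (rule ce_in_decidable)
  have comp: "test_component W m = (\<Union>w. \<Union>i\<in>{m + 2..}. ?F w i)" for m
  proof (intro subset_antisym subsetI)
    fix Y assume "Y \<in> test_component W m"
    then obtain \<sigma> where "Y \<in> cylinder \<sigma>" and W: "prod_encode (m, string_code \<sigma>) \<in> W"
      by (auto simp: test_component_def)
    then have "init_seg Y (length \<sigma>) = \<sigma>" by (simp add: cylinder_def)
    with W have "Y \<in> ?F (pfst (length \<sigma>)) (pfst (psnd (length \<sigma>)))"
      and "pfst (psnd (length \<sigma>)) \<in> {m + 2..}"
      by (auto simp: W_def approx_holds_init_seg[OF fam])
    then show "Y \<in> (\<Union>w. \<Union>i\<in>{m + 2..}. ?F w i)" by blast
  next
    fix Y assume "Y \<in> (\<Union>w. \<Union>i\<in>{m + 2..}. ?F w i)"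
    then obtain w i where i: "i \<ge> m + 2" and Y: "Y \<in> ?F w i" by blast
    \<comment> \<open>A Cantor code is at least as large as its last entry, so a prefix of this
      length names \<open>(w, i)\<close> and is also long enough for both stages.\<close>
    define n where "n = prod_encode (w, prod_encode (i, l w i + l w (Suc i)))"
    have "l w i + l w (Suc i) \<le> n"
      unfolding n_def by (meson le_prod_encode_2 order_trans)
    then have n: "l w i \<le> n" "l w (Suc i) \<le> n" by auto
    with i Y have "prod_encode (m, string_code (init_seg Y n)) \<in> W"
      by (auto simp: W_def approx_holds_init_seg[OF fam n(1)] approx_holds_init_seg[OF fam n(2)] n_def)
    moreover have "Y \<in> cylinder (init_seg Y n)" by (simp add: cylinder_def)
    ultimately show "Y \<in> test_component W m" unfolding test_component_def by blast
  qed
  have "measure \<mu> (test_component W m) \<le> (1/2) ^ m" for m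
    unfolding comp using fast unfolding fast_Cauchy_def
    by (intro measure_tail sets_approx_holds_neq) auto
  with ce have "ml_test_in A W" by (simp add: ml_test_in_def)
  with assms obtain m where m: "Z \<notin> test_component W m"
    unfolding ml_random_in_def by blast
  then have step: "approx_holds l d w i Z = approx_holds l d w (Suc i) Z" if "i \<ge> m + 2" for w i
    using that unfolding comp by blast
  have "approx_holds l d w i Z = approx_holds l d w (m + 2) Z" if "i \<ge> m + 2" for w i
    by (rule eventually_constant[where P = "\<lambda>i. approx_holds l d w i Z", OF step that])
  then show "\<exists>m. \<forall>w. \<forall>i\<ge>m. approx_holds l d w i Z = approx_holds l d w m Z" by blast
qed

lemma countable_computable: "countable {f. computable A f}"
proof (rule countable_subset)
  show "{f. computable A f} \<subseteq> range (\<lambda>p x. THE y. runs A p x y)"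
  proof
    fix f assume "f \<in> {f. computable A f}"
    then obtain p where "\<And>x. runs A p x (f x)" by (auto simp: computable_def)
    then have "f = (\<lambda>x. THE y. runs A p x y)"
      by (auto intro!: ext the_equality[symmetric] dest: runs_deterministic)
    then show "f \<in> range (\<lambda>p x. THE y. runs A p x y)" by blast
  qed
qed (simp add: countable_prog)

text \<open>A family is determined by its two computable functions, because every string is the
  decoding of its code.\<close>

lemma countable_clopen_family: "countable {(l, d). clopen_family A l d}"
proof (rule countable_subset)
  let ?h = "\<lambda>(f, g). (\<lambda>w i. f (prod_encode (w, i)),
    \<lambda>w i \<sigma>. g (prod_encode (w, prod_encode (i, string_code \<sigma>))) \<noteq> (0 :: nat))"
  show "{(l, d). clopen_family A l d} \<subseteq> ?h ` ({f. computable A f} \<times> {f. computable A f})"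
  proof (intro subsetI, clarify)
    fix l d assume "clopen_family A l d"
    then have "((\<lambda>x. l (pfst x) (psnd x)),
        (\<lambda>x. of_bool (d (pfst x) (pfst (psnd x)) (decode_string (psnd (psnd x))))))
        \<in> {f. computable A f} \<times> {f. computable A f}" (is "?z \<in> _")
      by (simp add: clopen_family_def)
    moreover have "(l, d) = ?h ?z" by (simp add: fun_eq_iff)
    ultimately show "(l, d) \<in> ?h ` ({f. computable A f} \<times> {f. computable A f})"
      by (rule image_eqI[rotated])
  qed
qed (intro countable_image countable_SIGMA countable_computable)

text \<open>There are only countably many families, so the exceptional null sets supplied by
  Borel-Cantelli can be united.\<close>

lemma AE_stabilizing: "AE Z in \<mu>. stabilizing A Z"
proof -
  let ?X = "{(l, d). clopen_family A l d} \<inter> {(l, d). fast_Cauchy l d}"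
  have "countable ?X" using countable_clopen_family by (rule countable_Int1)
  moreover have "AE Z in \<mu>. \<exists>m. \<forall>w. \<forall>i\<ge>m. approx_holds l d w i Z = approx_holds l d w m Z"
    if "(l, d) \<in> ?X" for l d
  proof -
    have "AE Z in \<mu>. \<exists>m. \<forall>w. \<forall>i\<ge>m.
        Z \<notin> {Z. approx_holds l d w i Z \<noteq> approx_holds l d w (Suc i) Z}"
      using that by (intro AE_not_in_tail sets_approx_holds_neq) (simp add: fast_Cauchy_def)
    then show ?thesis
    proof eventually_elim
      case (elim Z)
      then obtain m where m: "\<And>w i. i \<ge> m \<Longrightarrow> approx_holds l d w i Z \<longleftrightarrow> approx_holds l d w (Suc i) Z"
        by blast
      have "approx_holds l d w i Z = approx_holds l d w m Z" if "i \<ge> m" for w i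
        by (rule eventually_constant[where P = "\<lambda>i. approx_holds l d w i Z", OF m that])
      then show ?case by blast
    qed
  qed
  then have "\<forall>x\<in>?X. AE Z in \<mu>. \<exists>m. \<forall>w. \<forall>i\<ge>m.
      approx_holds (fst x) (snd x) w i Z = approx_holds (fst x) (snd x) w m Z"
    by auto
  ultimately have "AE Z in \<mu>. \<forall>x\<in>?X. \<exists>m. \<forall>w. \<forall>i\<ge>m.
      approx_holds (fst x) (snd x) w i Z = approx_holds (fst x) (snd x) w m Z"
    by (subst AE_ball_countable)
  then show ?thesis
  proof eventually_elim
    case (elim Z)
    show ?case
      unfolding stabilizing_def
    proof (intro allI impI)
      fix l d assume "clopen_family A l d \<and> fast_Cauchy l d"
      then have "(l, d) \<in> ?X" by simp
      from bspec[OF elim this]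
      show "\<exists>m. \<forall>w. \<forall>i\<ge>m. approx_holds l d w i Z = approx_holds l d w m Z"
        unfolding fst_conv snd_conv .
    qed
  qed
qed

section \<open>Negation and existential quantification of approximable classes\<close>

text \<open>Complementing every stage leaves the symmetric differences of consecutive stages
  unchanged, so the speed of convergence is preserved.\<close>

lemma approximable_not: "approximable A G \<Longrightarrow> approximable A (\<lambda>w Z. \<not> G w Z)"
  unfolding approximable_def
proof (elim exE conjE)
  fix l d assume fam: "clopen_family A l d" and fast: "fast_Cauchy l d"
    and lim: "\<forall>Z. stabilizing A Z \<longrightarrow> (\<forall>w. \<exists>m. \<forall>i\<ge>m. approx_holds l d w i Z = G w Z)"
  let ?d = "\<lambda>w i \<sigma>. \<not> d w i \<sigma>"
  have neg: "approx_holds l ?d w i Z \<longleftrightarrow> \<not> approx_holds l d w i Z" for w i Z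
    by (simp add: approx_holds_def)
  have "clopen_family A l ?d"
    unfolding clopen_family_def
  proof (intro conjI computable_intros computable_clopen_family[OF fam] decidable_clopen_family[OF fam])
    show "\<forall>w i \<sigma>. l w i \<le> length \<sigma> \<longrightarrow> (\<not> d w i (take (l w i) \<sigma>)) = (\<not> d w i \<sigma>)"
      using fam by (simp add: clopen_family_def)
  qed
  moreover have "fast_Cauchy l ?d"
    using fast unfolding fast_Cauchy_def neg by simp
  moreover have "\<forall>Z. stabilizing A Z \<longrightarrow> (\<forall>w. \<exists>m. \<forall>i\<ge>m. approx_holds l ?d w i Z = (\<not> G w Z))"
    using lim unfolding neg by simp
  ultimately show "\<exists>l d. clopen_family A l d \<and> fast_Cauchy l d \<and>
      (\<forall>Z. stabilizing A Z \<longrightarrow> (\<forall>w. \<exists>m. \<forall>i\<ge>m. approx_holds l d w i Z = (\<not> G w Z)))"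
    by blast
qed

text \<open>
  The finite unions of approximations converge to the union of the \<open>G\<close>'s, but without a computable
  rate. The jump supplies one, because "some later term differs by more than \<open>\<epsilon>\<close>" is c.e. The
  argument \<open>Suc (prod_encode (x, w))\<close> is the list code of \<open>x\<close> consed to the list coded by \<open>w\<close>.
\<close>

lemma approximable_jump_ex:
  assumes "approximable A G"
  shows "approximable (jump A) (\<lambda>w Z. \<exists>x. G (Suc (prod_encode (x, w))) Z)"
proof -
  from assms obtain l d where fam: "clopen_family A l d" and fast: "fast_Cauchy l d"
    and lim: "\<And>Z w. stabilizing A Z \<Longrightarrow> \<exists>m. \<forall>i\<ge>m. approx_holds l d w i Z = G w Z"
    unfolding approximable_def by blast
  let ?c = "\<lambda>x w. Suc (prod_encode (x, w))"
  let ?G = "\<lambda>w Z. \<exists>x. G (?c x w) Z"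
  \<comment> \<open>Stage \<open>t\<close> of the union takes stage \<open>t\<close> of the sets
    with \<open>x \<le> t\<close>. The sum of their lengths dominates each of them and is
    computable.\<close>
  define l' where "l' w t = (\<Sum>x<Suc t. l (?c x w) t)" for w t
  define d' where "d' w t \<sigma> \<longleftrightarrow> (\<exists>x<Suc t. d (?c x w) t \<sigma>)" for w t \<sigma>
  have l'_le: "l (?c x w) t \<le> l' w t" if "x < Suc t" for x w t
    unfolding l'_def using that by (intro member_le_sum) auto
  have fam': "clopen_family A l' d'"
    unfolding clopen_family_def
  proof (intro conjI allI impI)
    show "computable2 A l'"
      unfolding l'_def
      by (intro computable_intros computable_clopen_family[OF fam])
    show "decidable A (\<lambda>x. d' (pfst x) (pfst (psnd x)) (decode_string (psnd (psnd x))))"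
      unfolding d'_def
      by (intro computable_intros decidable_clopen_family[OF fam])
    fix w t and \<sigma> :: "bool list" assume "l' w t \<le> length \<sigma>"
    have "d (?c x w) t (take (l' w t) \<sigma>) = d (?c x w) t \<sigma>" if "x < Suc t" for x
    proof -
      have inv: "d (?c x w) t (take (l (?c x w) t) \<tau>) = d (?c x w) t \<tau>"
        if "l (?c x w) t \<le> length \<tau>" for \<tau>
        using fam that by (simp add: clopen_family_def)
      have "d (?c x w) t (take (l (?c x w) t) (take (l' w t) \<sigma>)) = d (?c x w) t (take (l' w t) \<sigma>)"
        using l'_le[OF that, of w] \<open>l' w t \<le> length \<sigma>\<close> by (intro inv) simp
      moreover have "take (l (?c x w) t) (take (l' w t) \<sigma>) = take (l (?c x w) t) \<sigma>"
        using l'_le[OF that, of w] by (simp add: min_absorb1)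
      moreover have "d (?c x w) t (take (l (?c x w) t) \<sigma>) = d (?c x w) t \<sigma>"
        using l'_le[OF that, of w] \<open>l' w t \<le> length \<sigma>\<close> by (intro inv) simp
      ultimately show ?thesis by simp
    qed
    then show "d' w t (take (l' w t) \<sigma>) = d' w t \<sigma>" unfolding d'_def by blast
  qed
  have holds': "approx_holds l' d' w t Z \<longleftrightarrow> (\<exists>x<Suc t. approx_holds l d (?c x w) t Z)" for w t Z
    using approx_holds_init_seg[OF fam l'_le] by (auto simp: approx_holds_def[of l'] d'_def)
  have lim': "\<exists>m. \<forall>t\<ge>m. approx_holds l' d' w t Z = ?G w Z" if "stabilizing A Z" for w Z
  proof -
    from that fam fast obtain m
      where m: "\<And>w i. i \<ge> m \<Longrightarrow> approx_holds l d w i Z = approx_holds l d w m Z"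
      unfolding stabilizing_def by blast
    \<comment> \<open>A value constant from \<open>m\<close> on equals the limit already at
      \<open>m\<close>, and this \<open>m\<close> is the same for all \<open>v\<close>.\<close>
    have G: "approx_holds l d v i Z = G v Z" if "i \<ge> m" for v i
    proof -
      from lim[OF \<open>stabilizing A Z\<close>] obtain k where "\<And>i. i \<ge> k \<Longrightarrow> approx_holds l d v i Z = G v Z" by blast
      from this[of "max m k"] show ?thesis using m[of "max m k" v] m[OF that] by simp
    qed
    show ?thesis
    proof (cases "?G w Z")
      case True
      then obtain x where x: "G (?c x w) Z" by blast
      \<comment> \<open>\<open>t \<ge> x\<close> brings the witness \<open>x\<close> into the finite
        union, and \<open>t \<ge> m\<close> makes its approximation correct.\<close>
      have "approx_holds l' d' w t Z" if "t \<ge> max m x" for t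
        using that x G unfolding holds' by (intro exI[of _ x]) auto
      with True show ?thesis by blast
    next
      case False
      then have "\<not> approx_holds l' d' w t Z" if "t \<ge> m" for t
        using that G unfolding holds' by auto
      with False show ?thesis by blast
    qed
  qed
  define close where "close w i t \<longleftrightarrow> (\<forall>n. measure \<mu>
    {Z. approx_holds l' d' w t Z \<noteq> approx_holds l' d' w (t + n) Z} \<le> (1/2) ^ (w + i))" for w i t
  \<comment> \<open>Convergence at almost every point implies convergence in measure, so a
    qualifying stage exists.\<close>
  have ex_close: "\<exists>t. i \<le> t \<and> close w i t" for w i
  proof -
    have "AE Z in \<mu>. \<exists>m. \<forall>t\<ge>m. approx_holds l' d' w t Z = approx_holds l' d' w m Z"
      using AE_stabilizing[of A] by eventually_elim (metis lim' order_refl)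
    from AE_stable_imp_Cauchy[OF sets_approx_holds this, of "(1/2) ^ (w + i)"]
    obtain m where "\<And>t t'. t \<ge> m \<Longrightarrow> t' \<ge> m \<Longrightarrow>
        measure \<mu> {Z. approx_holds l' d' w t Z \<noteq> approx_holds l' d' w t' Z} \<le> (1/2) ^ (w + i)"
      by auto
    then have "close w i (max i m)" by (simp add: close_def)
    then show ?thesis by (intro exI[of _ "max i m"]) auto
  qed
  \<comment> \<open>Both stages are evaluated on strings of the common length
    \<open>l' w t + l' w (t + n)\<close>. Clearing denominators leaves a comparison of natural
    numbers decidable in \<open>A\<close>, so \<open>close\<close> is the negation of an existential
    statement and \<open>jump A\<close> decides it.\<close>
  have close_iff: "close w i t \<longleftrightarrow> \<not> (\<exists>n. (2 :: nat) ^ (l' w t + l' w (t + n)) <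
      (\<Sum>v<2 ^ (l' w t + l' w (t + n)). of_bool (\<not> (d' w t (bits (l' w t + l' w (t + n)) v)
        \<longleftrightarrow> d' w (t + n) (bits (l' w t + l' w (t + n)) v)))) * 2 ^ (w + i))" for w i t
  proof -
    have "measure \<mu> {Z. approx_holds l' d' w t Z \<noteq> approx_holds l' d' w (t + n) Z} \<le> (1/2) ^ (w + i)
      \<longleftrightarrow> (\<Sum>v<2 ^ L. of_bool (\<not> (d' w t (bits L v) \<longleftrightarrow> d' w (t + n) (bits L v)))) * 2 ^ (w + i)
        \<le> (2 ^ L :: nat)" (is "_ \<longleftrightarrow> ?s * _ \<le> _")
      if L: "L = l' w t + l' w (t + n)" for n L
    proof -
      have "approx_holds l' d' w t Z = d' w t (init_seg Z L)"
        "approx_holds l' d' w (t + n) Z = d' w (t + n) (init_seg Z L)" for Z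
        by (rule approx_holds_init_seg[OF fam'], simp add: L)+
      then have "measure \<mu> {Z. approx_holds l' d' w t Z \<noteq> approx_holds l' d' w (t + n) Z}
          = real ?s / 2 ^ L"
        using measure_init_seg[of "\<lambda>\<sigma>. \<not> (d' w t \<sigma> \<longleftrightarrow> d' w (t + n) \<sigma>)" L] by (simp only:)
      also have "\<dots> \<le> (1/2) ^ (w + i) \<longleftrightarrow> real ?s * 2 ^ (w + i) \<le> 2 ^ L"
        by (simp only: power_one_over) (simp add: field_simps del: sum_of_bool_eq)
      also have "\<dots> \<longleftrightarrow> real (?s * 2 ^ (w + i)) \<le> real (2 ^ L)"
        by (simp only: of_nat_mult of_nat_power of_nat_numeral)
      finally show ?thesis by (simp only: of_nat_le_iff)
    qed
    then show ?thesis unfolding close_def by (simp only: not_ex not_less)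
  qed
  \<comment> \<open>\<open>close\<close> controls all later stages, while \<open>i \<le> t\<close>
    sends \<open>T w i\<close> to infinity and so keeps the limit.\<close>
  define T where "T w i = (LEAST t. i \<le> t \<and> close w i t)" for w i
  have T: "i \<le> T w i" "close w i (T w i)" for w i
    using LeastI_ex[OF ex_close] unfolding T_def by auto
  have "decidable (jump A) (\<lambda>x. close (pfst x) (pfst (psnd x)) (psnd (psnd x)))"
    unfolding close_iff
    by (intro decidable_not decidable_jump_ex computable_intros
        computable_clopen_family[OF fam'] decidable_clopen_family[OF fam'])
  from computable_comp[OF this, of "\<lambda>x. prod_encode (pfst (pfst x), prod_encode (psnd (pfst x), psnd x))"]
  have "decidable (jump A) (\<lambda>x. close (pfst (pfst x)) (psnd (pfst x)) (psnd x))"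
    by (simp add: computable_intros)
  then have comp_T: "computable2 (jump A) T"
    unfolding T_def by (intro computable_Least computable_intros ex_close)
  note fam'_jump = clopen_family_jump[OF fam']
  let ?l = "\<lambda>w i. l' w (T w i)" and ?d = "\<lambda>w i. d' w (T w i)"
  have holds: "approx_holds ?l ?d w i Z = approx_holds l' d' w (T w i) Z" for w i Z
    by (simp add: approx_holds_def)
  have "clopen_family (jump A) ?l ?d"
    unfolding clopen_family_def
  proof (intro conjI)
    show "computable2 (jump A) ?l"
      by (intro computable_clopen_family[OF fam'_jump] computable2_comp[OF comp_T] computable_intros)
    show "decidable (jump A) (\<lambda>x. ?d (pfst x) (pfst (psnd x)) (decode_string (psnd (psnd x))))"
      by (intro decidable_clopen_family[OF fam'_jump] computable2_comp[OF comp_T] computable_intros)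
    show "\<forall>w i \<sigma>. ?l w i \<le> length \<sigma> \<longrightarrow> ?d w i (take (?l w i) \<sigma>) = ?d w i \<sigma>"
      using fam' by (simp add: clopen_family_def)
  qed
  moreover have "fast_Cauchy ?l ?d"
    unfolding fast_Cauchy_def holds
  proof (intro allI)
    fix w i
    \<comment> \<open>The stage chosen for \<open>Suc i\<close> meets the weaker tolerance for
      \<open>i\<close> as well, so it competes in the minimum defining \<open>T w i\<close>. Hence
      \<open>T\<close> is monotone in \<open>i\<close>, and \<open>close\<close> bounds the
      difference of consecutive chosen stages.\<close>
    have "close w i (T w (Suc i))"
      unfolding close_def
    proof
      fix n
      have "measure \<mu> {Z. approx_holds l' d' w (T w (Suc i)) Z \<noteq> approx_holds l' d' w (T w (Suc i) + n) Z}
          \<le> (1/2) ^ (w + Suc i)"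
        using T(2)[of w "Suc i"] by (simp add: close_def)
      also have "\<dots> \<le> (1/2) ^ (w + i)" by (rule power_decreasing) auto
      finally show "measure \<mu> {Z. approx_holds l' d' w (T w (Suc i)) Z \<noteq> approx_holds l' d' w (T w (Suc i) + n) Z}
          \<le> (1/2) ^ (w + i)" .
    qed
    then have "T w i \<le> T w (Suc i)"
      unfolding T_def[of w i] using T(1)[of "Suc i" w] by (intro Least_le) auto
    then show "measure \<mu> {Z. approx_holds l' d' w (T w i) Z \<noteq> approx_holds l' d' w (T w (Suc i)) Z}
        \<le> (1/2) ^ (w + i)"
      using T(2)[of w i] unfolding close_def by (metis le_add_diff_inverse)
  qed
  moreover have "\<exists>m. \<forall>i\<ge>m. approx_holds ?l ?d w i Z = ?G w Z" if "stabilizing (jump A) Z" for Z w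
    using lim'[OF stabilizing_jump[OF that], of w] unfolding holds by (meson T(1) order_trans)
  ultimately show ?thesis unfolding approximable_def by blast
qed


section \<open>Arithmetical classes\<close>

lemma computable_rel_in_iff:
  "computable_rel_in A R \<longleftrightarrow> decidable A (\<lambda>x. R (list_decode (pfst x)) (decode_string (psnd x)))"
proof
  assume "computable_rel_in A R"
  then obtain p where p: "\<And>ys \<sigma>. runs A p (prod_encode (list_encode ys, string_code \<sigma>)) (of_bool (R ys \<sigma>))"
    unfolding computable_rel_in_def by blast
  \<comment> \<open>\<open>p\<close> is specified only on codes of strings; decoding and encoding
    again first normalises an arbitrary number.\<close>
  have "computable A (\<lambda>x. prod_encode (pfst x, string_code (decode_string (psnd x))))"
    by (intro computable_intros)
  then obtain q where "\<And>x. runs A q x (prod_encode (pfst x, string_code (decode_string (psnd x))))"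
    unfolding computable_def by blast
  from runs.comp[OF this] p[of "list_decode (pfst x)" "decode_string (psnd x)" for x]
  show "decidable A (\<lambda>x. R (list_decode (pfst x)) (decode_string (psnd x)))"
    unfolding computable_def by (metis list_decode_inverse)
next
  assume "decidable A (\<lambda>x. R (list_decode (pfst x)) (decode_string (psnd x)))"
  then obtain p where p: "\<And>x. runs A p x (of_bool (R (list_decode (pfst x)) (decode_string (psnd x))))"
    unfolding computable_def by blast
  show "computable_rel_in A R"
    unfolding computable_rel_in_def
  proof (intro exI allI)
    fix ys \<sigma>
    show "runs A p (prod_encode (list_encode ys, string_code \<sigma>)) (of_bool (R ys \<sigma>))"
      using p[of "prod_encode (list_encode ys, string_code \<sigma>)"] by simp
  qed
qed

lemma pi_form_iff_not_sigma_form: "pi_form k R Z \<longleftrightarrow> \<not> sigma_form k (\<lambda>ys \<sigma>. \<not> R ys \<sigma>) Z"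
  by (induction k arbitrary: R) auto

lemma sets_sigma_form: "{Z. sigma_form k R Z} \<in> sets \<mu>"
proof (induction k arbitrary: R)
  case 0
  have "{Z. sigma_form 0 R Z} = (\<Union>y. {Z. R [] (init_seg Z y)})" by auto
  then show ?case using sets_init_seg by auto
next
  case (Suc k)
  have "{Z. sigma_form (Suc k) R Z} = (\<Union>y. UNIV - {Z. sigma_form k (\<lambda>ys \<sigma>. \<not> R (y # ys) \<sigma>) Z})"
    by (auto simp: pi_form_iff_not_sigma_form)
  also have "\<dots> \<in> sets \<mu>"
    using Suc sets.top[of \<mu>] by (intro sets.countable_UN'' sets.Diff) auto
  finally show ?case .
qed

lemma sets_pi_form: "{Z. pi_form k R Z} \<in> sets \<mu>"
proof -
  have "{Z. pi_form k R Z} = UNIV - {Z. sigma_form k (\<lambda>ys \<sigma>. \<not> R ys \<sigma>) Z}"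
    by (auto simp: pi_form_iff_not_sigma_form)
  then show ?thesis using sets_sigma_form sets.top[of \<mu>] by auto
qed

text \<open>Here \<open>w\<close> codes a list \<open>y # ws\<close>, where \<open>ws\<close> holds the outer quantified variables, innermost
  first, and \<open>y\<close> is the length of the prefix.\<close>

lemma approximable_init_seg:
  assumes "computable_rel_in A R"
  shows "approximable A (\<lambda>w Z. R (rev (tl (list_decode w))) (init_seg Z (pfst (w - 1))))"
proof -
  \<comment> \<open>Neither length nor predicate depends on \<open>i\<close>, so consecutive stages
    coincide and the Cauchy condition is trivial.\<close>
  let ?l = "\<lambda>w i. pfst (w - 1)"
  let ?d = "\<lambda>w i \<sigma>. R (rev (tl (list_decode w))) (take (pfst (w - 1)) \<sigma>)"
  have R: "decidable A (\<lambda>x. R (list_decode (pfst x)) (decode_string (psnd x)))"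
    using assms by (simp add: computable_rel_in_iff)
  have "computable A (\<lambda>x. prod_encode (list_encode (rev (tl (list_decode (pfst x)))),
      string_code (take (pfst (pfst x - 1)) (decode_string (psnd (psnd x))))))"
    by (intro computable_intros computable_comp[OF list_decode_comp])
  from computable_comp[OF R this]
  have "decidable A (\<lambda>x. ?d (pfst x) (pfst (psnd x)) (decode_string (psnd (psnd x))))" by simp
  moreover have "computable2 A ?l" by (intro computable_intros)
  ultimately have "clopen_family A ?l ?d"
    unfolding clopen_family_def by simp
  moreover have "approx_holds ?l ?d w i Z \<longleftrightarrow> R (rev (tl (list_decode w))) (init_seg Z (pfst (w - 1)))" for w i Z
    by (simp add: approx_holds_def)
  ultimately show ?thesis
    unfolding approximable_def by (intro exI[of _ ?l] exI[of _ ?d]) (auto simp: fast_Cauchy_def)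
qed

section \<open>One jump for each quantifier\<close>

lemma iter_jump_Suc: "iter_jump (Suc k) = jump (iter_jump k)"
  by (simp add: iter_jump_def)

lemma computable_rel_in_not:
  "computable_rel_in A R \<Longrightarrow> computable_rel_in A (\<lambda>ys \<sigma>. \<not> R ys \<sigma>)"
  unfolding computable_rel_in_iff by (rule decidable_not)

text \<open>Each existential quantifier costs one jump and negation costs none, so
  \<open>k + 1\<close> quantifiers take \<open>k + 1\<close> jumps. New variables are consed onto
  the code \<open>w\<close>, hence \<open>rev\<close> restores the order of quantification.\<close>

lemma approximable_sigma_form:
  assumes "computable_rel_in {} R"
  shows "approximable (iter_jump (Suc k))
    (\<lambda>w Z. sigma_form k (\<lambda>ys. R (rev (list_decode w) @ ys)) Z)"
  using assms
proof (induction k arbitrary: R)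
  case 0
  from approximable_jump_ex[OF approximable_init_seg[OF 0]] show ?case
    by (simp add: iter_jump_def)
next
  case (Suc k)
  from approximable_jump_ex[OF approximable_not[OF Suc.IH[OF computable_rel_in_not[OF Suc.prems]]]]
  show ?case
    by (simp add: iter_jump_Suc[of "Suc k"] pi_form_iff_not_sigma_form)
qed

theorem theorem7p2:
  fixes n :: nat and Z :: cantor and P :: "cantor set"
  assumes "n \<ge> 1"
    and "density_random_in (iter_jump (n - 1)) Z"
    and "pi_class {} n P"
    and "Z \<in> P"
  shows "lower_density P Z = 1"
proof (cases "n = 1")
  case True
  with assms show ?thesis by (simp add: iter_jump_def density_random_in_def)
next
  case False
  with \<open>n \<ge> 1\<close> obtain k where n: "n = Suc (Suc k)"
    by (metis One_nat_def Suc_le_D not0_implies_Suc)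
  \<comment> \<open>With \<open>n = k + 2\<close>, stripping the outer universal quantifier leaves
    \<open>sigma_form k\<close>, for which \<open>k + 1 = n - 1\<close> jumps suffice: exactly the
    oracle of the randomness assumption.\<close>
  define A where "A = iter_jump (Suc k)"
  from assms(2) have random: "density_random_in A Z" by (simp add: n A_def)
  from assms(3) obtain R where R: "computable_rel_in {} R" and P: "P = {Z. pi_form (Suc k) R Z}"
    unfolding pi_class_def n by (auto simp del: pi_form.simps)
  from approximable_sigma_form[OF R, of k, folded A_def]
  obtain l d where fam: "clopen_family A l d" and fast: "fast_Cauchy l d"
    and lim: "\<And>Z w. stabilizing A Z \<Longrightarrow>
      \<exists>m. \<forall>i\<ge>m. approx_holds l d w i Z = sigma_form k (\<lambda>ys. R (rev (list_decode w) @ ys)) Z"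
    unfolding approximable_def by blast
  \<comment> \<open>The code of the one-element list \<open>[y]\<close>, since 0 codes the empty
    list.\<close>
  let ?c = "\<lambda>y. Suc (prod_encode (y, 0))"
  have lim_c: "\<exists>m. \<forall>i\<ge>m. approx_holds l d (?c y) i Y = sigma_form k (\<lambda>ys. R (y # ys)) Y"
    if "stabilizing A Y" for y Y
    using lim[OF that, of "?c y"] by simp
  have "stabilizing A Z"
    using random by (simp add: density_random_in_def ml_random_imp_stabilizing)
  with fam fast obtain m where m: "\<And>w i. i \<ge> m \<Longrightarrow> approx_holds l d w i Z = approx_holds l d w m Z"
    unfolding stabilizing_def by blast
  \<comment> \<open>The length of \<open>\<sigma>\<close> codes the pair \<open>(y, i)\<close> to be
    checked. A string too short for that stage imposes no condition, so one universal quantifier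
    over prefixes covers all pairs.\<close>
  define S where "S ys \<sigma> \<longleftrightarrow> m \<le> pfst (psnd (length \<sigma>)) \<and>
      l (?c (pfst (length \<sigma>))) (pfst (psnd (length \<sigma>))) \<le> length \<sigma> \<longrightarrow>
      d (?c (pfst (length \<sigma>))) (pfst (psnd (length \<sigma>))) \<sigma>" for ys :: "nat list" and \<sigma>
  define Q where "Q = {Y. pi_form 0 S Y}"
  have "computable_rel_in A S"
    unfolding computable_rel_in_iff S_def
    by (intro computable_intros computable_clopen_family[OF fam] decidable_clopen_family[OF fam])
  then have Q_class: "pi_class A 1 Q"
    unfolding pi_class_def Q_def by auto
  have Q: "Y \<in> Q \<longleftrightarrow> (\<forall>y. \<forall>i\<ge>m. approx_holds l d (?c y) i Y)" for Y
  proof (intro iffI allI impI)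
    fix y i assume "Y \<in> Q" "i \<ge> m"
    \<comment> \<open>Again the last entry pads the code, so that the prefix of length
      \<open>j\<close> is long enough for the stage it names.\<close>
    define j where "j = prod_encode (y, prod_encode (i, l (?c y) i))"
    have j: "l (?c y) i \<le> j"
      unfolding j_def by (meson le_prod_encode_2 order_trans)
    from \<open>Y \<in> Q\<close> have "S [] (init_seg Y j)" by (simp add: Q_def)
    with \<open>i \<ge> m\<close> j show "approx_holds l d (?c y) i Y"
      unfolding approx_holds_init_seg[OF fam j] by (simp add: S_def j_def)
  next
    assume "\<forall>y. \<forall>i\<ge>m. approx_holds l d (?c y) i Y"
    then show "Y \<in> Q"
      by (auto simp: Q_def S_def approx_holds_init_seg[OF fam, symmetric])
  qed
  \<comment> \<open>Since \<open>Z \<in> P\<close>, every limit at \<open>Z\<close> is true, and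
    stability from \<open>m\<close> on carries this back to all stages
    \<open>i \<ge> m\<close>.\<close>
  have "Z \<in> Q"
    unfolding Q
  proof (intro allI impI)
    fix y i assume "i \<ge> m"
    from lim_c[OF \<open>stabilizing A Z\<close>] obtain j where
      "\<And>i. i \<ge> j \<Longrightarrow> approx_holds l d (?c y) i Z = sigma_form k (\<lambda>ys. R (y # ys)) Z" by blast
    from this[of "max m j"] \<open>Z \<in> P\<close> have "approx_holds l d (?c y) (max m j) Z"
      by (simp add: P)
    with m[of "max m j"] m[OF \<open>i \<ge> m\<close>] show "approx_holds l d (?c y) i Z" by simp
  qed
  with random Q_class have "lower_density Q Z = 1"
    by (simp add: density_random_in_def)
  \<comment> \<open>At a stabilizing \<open>Y \<in> Q\<close> all approximations from
    \<open>m\<close> on hold, so each limit is true and \<open>Y \<in> P\<close>.\<close>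
  moreover have "AE Y in \<mu>. Y \<in> Q \<longrightarrow> Y \<in> P"
    using AE_stabilizing[of A]
  proof eventually_elim
    case (elim Y)
    show ?case
      unfolding Q P using lim_c[OF elim] by (auto intro: max.cobounded1) (meson max.cobounded1 max.cobounded2)
  qed
  then have "lower_density Q Z \<le> lower_density P Z"
    by (rule lower_density_mono) (simp add: P sets_pi_form del: pi_form.simps)
  ultimately show ?thesis
    using lower_density_le_1[of P Z] by (intro antisym) simp_all
qed

end
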